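(* (In ZF together with the Axiom of Determinacy AD.) Let $E$ be an equivalence relation on ${}^{\omega}2$ with $E\supseteq E_0$ such that there are no $s\in{}^{<\omega}2$ and $x\in{}^{\omega}2$ with $s^\frown x\;E\;s^\frown f(x)$. Then ${}^{\omega}2/E$ cannot be linearly ordered.
   Context: ${}^{\omega}2$ is the set of infinite binary sequences and ${}^{<\omega}2$ the set of finite binary sequences; $s^\frown x$ denotes concatenation. $E_0$ is the equivalence relation on ${}^{\omega}2$ of eventual equality: $x\,E_0\,y$ iff $x(n)=y(n)$ for all but finitely many $n$. The flip $f$ maps a (finite or infinite) binary sequence $s$ to the sequence $j\mapsto 1-s(j)$. ${}^{\omega}2/E$ is the set of $E$-equivalence classes; "cannot be linearly ordered" means there is no linear order on this set. *)

theory Defs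
  imports Main
begin

text \<open>
  HOL has a choice operator, which refutes the Axiom of Determinacy for HOL's own sets of
  sequences.  Determinacy is therefore assumed of a model of first-order ZF: an arbitrary
  type \<open>'v\<close> with a binary relation \<open>mem\<close>.  That a statement holds in all models of ZF + AD is,
  by completeness, the same as its being a theorem of ZF + AD (countable models already suffice,
  so letting the universe be a whole type loses nothing).

  Only the two axiom schemes need a syntax of formulas.  They must range over first-order
  formulas with parameters and not over all HOL predicates: the second-order schemes together
  with choice in HOL would give choice in the model.
\<close>

datatype fm = Mem nat nat | Eq nat nat | Neg fm | Conj fm fm | All nat fm

primrec sat :: "('v \<Rightarrow> 'v \<Rightarrow> bool) \<Rightarrow> fm \<Rightarrow> (nat \<Rightarrow> 'v) \<Rightarrow> bool" where
  "sat mem (Mem i j) \<rho> \<longleftrightarrow> mem (\<rho> i) (\<rho> j)"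
| "sat mem (Eq i j) \<rho> \<longleftrightarrow> \<rho> i = \<rho> j"
| "sat mem (Neg p) \<rho> \<longleftrightarrow> \<not> sat mem p \<rho>"
| "sat mem (Conj p q) \<rho> \<longleftrightarrow> sat mem p \<rho> \<and> sat mem q \<rho>"
| "sat mem (All i p) \<rho> \<longleftrightarrow> (\<forall>a. sat mem p (\<rho>(i := a)))"

text \<open>
  In the schemes, the assignment \<open>\<rho>\<close> supplies the parameters of the formula \<open>\<phi>\<close>; variables 0
  and 1 are the distinguished ones.
\<close>

locale ZF =
  fixes mem :: "'v \<Rightarrow> 'v \<Rightarrow> bool" (infix \<open>\<^bold>\<in>\<close> 50)
  assumes extensionality: "\<And>x y. (\<And>w. w \<^bold>\<in> x \<longleftrightarrow> w \<^bold>\<in> y) \<Longrightarrow> x = y"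
    and foundation: "\<And>x. \<exists>y. y \<^bold>\<in> x \<Longrightarrow> \<exists>y. y \<^bold>\<in> x \<and> \<not> (\<exists>z. z \<^bold>\<in> x \<and> z \<^bold>\<in> y)"
    and pairing: "\<And>x y. \<exists>z. \<forall>w. w \<^bold>\<in> z \<longleftrightarrow> w = x \<or> w = y"
    and union: "\<And>x. \<exists>u. \<forall>w. w \<^bold>\<in> u \<longleftrightarrow> (\<exists>y. y \<^bold>\<in> x \<and> w \<^bold>\<in> y)"
    and powerset: "\<And>x. \<exists>p. \<forall>y. y \<^bold>\<in> p \<longleftrightarrow> (\<forall>w. w \<^bold>\<in> y \<longrightarrow> w \<^bold>\<in> x)"
    and infinity: "\<exists>I. (\<exists>e. e \<^bold>\<in> I \<and> (\<forall>w. \<not> w \<^bold>\<in> e)) \<and>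
        (\<forall>x. x \<^bold>\<in> I \<longrightarrow> (\<exists>s. s \<^bold>\<in> I \<and> (\<forall>w. w \<^bold>\<in> s \<longleftrightarrow> w \<^bold>\<in> x \<or> w = x)))"
    and separation: "\<And>\<phi> \<rho> A. \<exists>B. \<forall>x. x \<^bold>\<in> B \<longleftrightarrow> x \<^bold>\<in> A \<and> sat mem \<phi> (\<rho>(0 := x))"
    and replacement: "\<And>\<phi> \<rho> A. (\<And>x. x \<^bold>\<in> A \<Longrightarrow> \<exists>!y. sat mem \<phi> (\<rho>(0 := x, 1 := y))) \<Longrightarrow>
        \<exists>B. \<forall>y. y \<^bold>\<in> B \<longleftrightarrow> (\<exists>x. x \<^bold>\<in> A \<and> sat mem \<phi> (\<rho>(0 := x, 1 := y)))"

text \<open>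
  The usual set-theoretic vocabulary, interpreted in the structure.  The locale has no axioms, so
  the definitions are unconditional; \<open>compr P\<close> is meaningful whenever the class given by \<open>P\<close> is a
  set of the structure, and every instance used below is one in ZF.
\<close>

locale universe =
  fixes mem :: "'v \<Rightarrow> 'v \<Rightarrow> bool" (infix \<open>\<^bold>\<in>\<close> 50)
begin

definition compr :: "('v \<Rightarrow> bool) \<Rightarrow> 'v" where
  "compr P = (THE z. \<forall>w. w \<^bold>\<in> z \<longleftrightarrow> P w)"

definition subset :: "'v \<Rightarrow> 'v \<Rightarrow> bool" (infix \<open>\<^bold>\<subseteq>\<close> 50) where
  "x \<^bold>\<subseteq> y \<longleftrightarrow> (\<forall>w. w \<^bold>\<in> x \<longrightarrow> w \<^bold>\<in> y)"

definition empty :: 'v where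
  "empty = compr (\<lambda>w. False)"

definition upair :: "'v \<Rightarrow> 'v \<Rightarrow> 'v" where
  "upair x y = compr (\<lambda>w. w = x \<or> w = y)"

definition opair :: "'v \<Rightarrow> 'v \<Rightarrow> 'v" where
  "opair x y = upair (upair x x) (upair x y)"

definition prod_set :: "'v \<Rightarrow> 'v \<Rightarrow> 'v" where
  "prod_set A B = compr (\<lambda>p. \<exists>x y. x \<^bold>\<in> A \<and> y \<^bold>\<in> B \<and> p = opair x y)"

definition dom :: "'v \<Rightarrow> 'v" where
  "dom f = compr (\<lambda>x. \<exists>y. opair x y \<^bold>\<in> f)"

definition app :: "'v \<Rightarrow> 'v \<Rightarrow> 'v" where
  "app f x = (THE y. opair x y \<^bold>\<in> f)"

definition funs :: "'v \<Rightarrow> 'v \<Rightarrow> 'v" where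
  "funs A B = compr (\<lambda>f. f \<^bold>\<subseteq> prod_set A B \<and> (\<forall>x. x \<^bold>\<in> A \<longrightarrow> (\<exists>!y. opair x y \<^bold>\<in> f)))"

definition restr :: "'v \<Rightarrow> 'v \<Rightarrow> 'v" where
  "restr f A = compr (\<lambda>p. p \<^bold>\<in> f \<and> (\<exists>x y. x \<^bold>\<in> A \<and> p = opair x y))"

definition succ :: "'v \<Rightarrow> 'v" where
  "succ x = compr (\<lambda>w. w \<^bold>\<in> x \<or> w = x)"

definition is_inductive :: "'v \<Rightarrow> bool" where
  "is_inductive I \<longleftrightarrow> empty \<^bold>\<in> I \<and> (\<forall>x. x \<^bold>\<in> I \<longrightarrow> succ x \<^bold>\<in> I)"

definition omega :: 'v where
  "omega = compr (\<lambda>n. \<forall>I. is_inductive I \<longrightarrow> n \<^bold>\<in> I)"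

abbreviation zero :: 'v where
  "zero \<equiv> empty"

definition one :: 'v where
  "one = succ zero"

definition two :: 'v where
  "two = succ one"

definition add :: "'v \<Rightarrow> 'v \<Rightarrow> 'v" where
  "add m n = (THE k. \<exists>g. g \<^bold>\<in> funs omega omega \<and> app g zero = m \<and>
     (\<forall>i. i \<^bold>\<in> omega \<longrightarrow> app g (succ i) = succ (app g i)) \<and> k = app g n)"

definition finite_set :: "'v \<Rightarrow> bool" where
  "finite_set A \<longleftrightarrow> (\<exists>n f. n \<^bold>\<in> omega \<and> f \<^bold>\<in> funs n A \<and>
     (\<forall>i j. i \<^bold>\<in> n \<longrightarrow> j \<^bold>\<in> n \<longrightarrow> app f i = app f j \<longrightarrow> i = j) \<and>
     (\<forall>a. a \<^bold>\<in> A \<longrightarrow> (\<exists>i. i \<^bold>\<in> n \<and> app f i = a)))"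

definition finseqs :: "'v \<Rightarrow> 'v" where
  "finseqs B = compr (\<lambda>s. \<exists>n. n \<^bold>\<in> omega \<and> s \<^bold>\<in> funs n B)"

definition equivalence_on :: "'v \<Rightarrow> 'v \<Rightarrow> bool" where
  "equivalence_on X R \<longleftrightarrow> R \<^bold>\<subseteq> prod_set X X \<and>
     (\<forall>x. x \<^bold>\<in> X \<longrightarrow> opair x x \<^bold>\<in> R) \<and>
     (\<forall>x y. opair x y \<^bold>\<in> R \<longrightarrow> opair y x \<^bold>\<in> R) \<and>
     (\<forall>x y z. opair x y \<^bold>\<in> R \<longrightarrow> opair y z \<^bold>\<in> R \<longrightarrow> opair x z \<^bold>\<in> R)"

definition quotient :: "'v \<Rightarrow> 'v \<Rightarrow> 'v" where
  "quotient X R = compr (\<lambda>c. \<exists>x. x \<^bold>\<in> X \<and> c = compr (\<lambda>y. opair x y \<^bold>\<in> R))"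

definition linear_order_on :: "'v \<Rightarrow> 'v \<Rightarrow> bool" where
  "linear_order_on X L \<longleftrightarrow> L \<^bold>\<subseteq> prod_set X X \<and>
     (\<forall>x. x \<^bold>\<in> X \<longrightarrow> opair x x \<^bold>\<in> L) \<and>
     (\<forall>x y. opair x y \<^bold>\<in> L \<longrightarrow> opair y x \<^bold>\<in> L \<longrightarrow> x = y) \<and>
     (\<forall>x y z. opair x y \<^bold>\<in> L \<longrightarrow> opair y z \<^bold>\<in> L \<longrightarrow> opair x z \<^bold>\<in> L) \<and>
     (\<forall>x y. x \<^bold>\<in> X \<longrightarrow> y \<^bold>\<in> X \<longrightarrow> opair x y \<^bold>\<in> L \<or> opair y x \<^bold>\<in> L)"

definition cantor :: 'v where
  "cantor = funs omega two"

definition E0 :: 'v where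
  "E0 = compr (\<lambda>p. \<exists>x y. x \<^bold>\<in> cantor \<and> y \<^bold>\<in> cantor \<and> p = opair x y \<and>
     finite_set (compr (\<lambda>n. n \<^bold>\<in> omega \<and> app x n \<noteq> app y n)))"

definition flip :: "'v \<Rightarrow> 'v" where
  "flip s = compr (\<lambda>p. \<exists>j. j \<^bold>\<in> dom s \<and>
     p = opair j (if app s j = zero then one else zero))"

text \<open>
  The length of a finite sequence is its domain, so \<open>concat s x\<close> sends \<open>i\<close> to \<open>s(i)\<close> below that
  length and the length plus \<open>j\<close> to \<open>x(j)\<close>.
\<close>

definition concat :: "'v \<Rightarrow> 'v \<Rightarrow> 'v" where
  "concat s x = compr (\<lambda>p. p \<^bold>\<in> s \<or>
     (\<exists>j. j \<^bold>\<in> dom x \<and> p = opair (add (dom s) j) (app x j)))"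

text \<open>
  In the game with payoff set \<open>A\<close>, players I and II alternately play natural numbers, I moving at
  the even and II at the odd positions, and I wins iff the resulting sequence is in \<open>A\<close>.  A
  strategy is defined on all finite sequences; its values at positions where the other player
  moves are ignored.
\<close>

definition follows_I :: "'v \<Rightarrow> 'v \<Rightarrow> bool" where
  "follows_I \<sigma> x \<longleftrightarrow> (\<forall>n. n \<^bold>\<in> omega \<longrightarrow>
     app x (add n n) = app \<sigma> (restr x (add n n)))"

definition follows_II :: "'v \<Rightarrow> 'v \<Rightarrow> bool" where
  "follows_II \<tau> x \<longleftrightarrow> (\<forall>n. n \<^bold>\<in> omega \<longrightarrow>
     app x (succ (add n n)) = app \<tau> (restr x (succ (add n n))))"

definition determined :: "'v \<Rightarrow> bool" where
  "determined A \<longleftrightarrow>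
     (\<exists>\<sigma>. \<sigma> \<^bold>\<in> funs (finseqs omega) omega \<and>
        (\<forall>x. x \<^bold>\<in> funs omega omega \<longrightarrow> follows_I \<sigma> x \<longrightarrow> x \<^bold>\<in> A)) \<or>
     (\<exists>\<tau>. \<tau> \<^bold>\<in> funs (finseqs omega) omega \<and>
        (\<forall>x. x \<^bold>\<in> funs omega omega \<longrightarrow> follows_II \<tau> x \<longrightarrow> \<not> x \<^bold>\<in> A))"

definition AD :: bool where
  "AD \<longleftrightarrow> (\<forall>A. A \<^bold>\<subseteq> funs omega omega \<longrightarrow> determined A)"

end

end

theory Submission
  imports Defs
begin

text \<open>
  Suppose \<open>L\<close> orders the classes and call \<open>x\<close> good if \<open>[x] L [flip x]\<close>.  Goodness is invariant
  under finite changes, and exactly one of \<open>x\<close> and \<open>flip x\<close> is good.  Two players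
  alternately choose \<open>y 0 < y 1 < \<dots>\<close> (whoever first breaks the increase loses), and I wins iff the
  characteristic function of the union of the blocks \<open>[y i, y (i + 1))\<close> with \<open>i\<close> even is good.
  Deleting \<open>y 0\<close> flips this sequence up to finitely many values and hence exchanges winning and
  losing.  So neither player has a winning strategy: a strategy for II would win both a run
  and its shift once it is used to answer itself, and one for I becomes a strategy for II
  when the first move is fixed.
\<close>

section \<open>Definable classes\<close>

text \<open>The naturals of the model may be nonstandard and its sequences are elements of
  \<open>'v\<close> rather than HOL functions. HOL's own induction and recursion therefore do not
  reach them, and runs have to be constructed inside the model. Every class that is to be a set,
  above all the payoff set handed to AD, and every induction predicate must be shown definable; most
  of the development serves this. Operations given by \<open>THE\<close>, such as \<open>app\<close>
  and \<open>add\<close>, are obstacles because they are unspecified off their intended domain. The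
  game is the classical one that derives non-determinacy from a nonprincipal ultrafilter on omega.
  Goodness replaces membership in the ultrafilter: finite changes preserve it and complementation
  reverses it. With increasing sequences as runs, a run and its shift share all later endpoints, so
  deleting one move merely hands each block to the other player.\<close>

primrec rename_fm :: "(nat \<Rightarrow> nat) \<Rightarrow> fm \<Rightarrow> fm" where
  "rename_fm f (Mem i j) = Mem (f i) (f j)"
| "rename_fm f (Eq i j) = Eq (f i) (f j)"
| "rename_fm f (Neg p) = Neg (rename_fm f p)"
| "rename_fm f (Conj p q) = Conj (rename_fm f p) (rename_fm f q)"
| "rename_fm f (All i p) = All (f i) (rename_fm f p)"

text \<open>Bound variables are renamed along with the free ones. Injectivity rules out capture: an
  update at \<open>f i\<close> touches no renamed variable other than that of
  \<open>i\<close>.\<close>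

lemma sat_rename_fm: "inj f \<Longrightarrow> sat mem (rename_fm f \<phi>) \<rho> \<longleftrightarrow> sat mem \<phi> (\<lambda>n. \<rho> (f n))"
proof (induction \<phi> arbitrary: \<rho>)
  case (All i p)
  have "(\<lambda>n. (\<rho>(f i := a)) (f n)) = (\<lambda>n. \<rho> (f n))(i := a)" for a
    using All.prems by (auto simp: fun_eq_iff inj_eq)
  with All show ?case by simp
qed simp_all

definition interleave :: "(nat \<Rightarrow> 'v) \<Rightarrow> (nat \<Rightarrow> 'v) \<Rightarrow> nat \<Rightarrow> 'v" where
  "interleave \<rho> p n = (if even n then \<rho> (n div 2) else p (n div 2))"

lemma interleave_simps [simp]:
  "interleave \<rho> p (2 * k) = \<rho> k" "interleave \<rho> p (Suc (2 * k)) = p k"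
  by (simp_all add: interleave_def)

lemma comp_interleave: "(\<lambda>n. F (interleave a b n)) = interleave (\<lambda>n. F (a n)) (\<lambda>n. F (b n))"
  by (auto simp: interleave_def)

lemma inj_interleave:
  assumes "inj a" "inj b" "\<And>i j. a i \<noteq> b j"
  shows "inj (interleave a b)"
proof (rule injI)
  fix m n assume *: "interleave a b m = interleave a b n"
  obtain i j where ij: "m = 2 * i \<or> m = Suc (2 * i)" "n = 2 * j \<or> n = Suc (2 * j)"
    by (metis evenE oddE Suc_eq_plus1)
  from ij * show "m = n"
    by (elim disjE) (simp_all add: inj_eq[OF assms(1)] inj_eq[OF assms(2)] assms(3) assms(3)[symmetric])
qed

lemma interleave_fun_upd: "(interleave \<rho> p)(0 := x) = interleave (\<rho>(0 := x)) p"
  by (auto simp: interleave_def fun_eq_iff elim!: evenE)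

locale zf_universe = ZF mem + universe mem
  for mem :: "'v \<Rightarrow> 'v \<Rightarrow> bool" (infix \<open>\<^bold>\<in>\<close> 50)
begin

text \<open>
  Separation and induction in the model apply to first-order formulas with parameters only.
  The even variables of the formula carry the assignment and the odd ones the parameters, so that
  there is always room for more of either.  A bound variable is variable 0 of the shifted
  assignment (de Bruijn); this makes the closure rules below applicable by resolution.
\<close>

definition definable :: "((nat \<Rightarrow> 'v) \<Rightarrow> bool) \<Rightarrow> bool" where
  "definable P \<longleftrightarrow> (\<exists>\<phi> p. \<forall>\<rho>. P \<rho> \<longleftrightarrow> sat mem \<phi> (interleave \<rho> p))"

text \<open>Terms have no syntax here, so the graph stands for the term: variable 0 holds the value,
  and the others, shifted down, hold the arguments.\<close>

definition definable_term :: "((nat \<Rightarrow> 'v) \<Rightarrow> 'v) \<Rightarrow> bool" where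
  "definable_term t \<longleftrightarrow> definable (\<lambda>\<rho>. \<rho> 0 = t (\<lambda>n. \<rho> (Suc n)))"

named_theorems def_intros

lemma definable_reindex:
  assumes "definable P" "inj f"
  shows "definable (\<lambda>\<rho>. P (\<lambda>n. \<rho> (f n)))"
proof -
  obtain \<phi> p where \<phi>: "\<And>\<rho>. P \<rho> \<longleftrightarrow> sat mem \<phi> (interleave \<rho> p)"
    using assms(1) by (auto simp: definable_def)
  let ?g = "interleave (\<lambda>n. 2 * f n) (\<lambda>n. Suc (2 * n))"
  have inj: "inj ?g"
    using assms(2) by (intro inj_interleave) (auto simp: inj_def, presburger)
  have "P (\<lambda>n. \<rho> (f n)) \<longleftrightarrow> sat mem (rename_fm ?g \<phi>) (interleave \<rho> p)" for \<rho>
    by (simp add: sat_rename_fm[OF inj] \<phi> comp_interleave[of "interleave \<rho> p"])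
  then show ?thesis
    by (auto simp: definable_def)
qed

lemma definable_neg [def_intros]: "definable P \<Longrightarrow> definable (\<lambda>\<rho>. \<not> P \<rho>)"
  unfolding definable_def by (metis sat.simps(3))

lemma definable_conj [def_intros]:
  assumes "definable P" "definable Q"
  shows "definable (\<lambda>\<rho>. P \<rho> \<and> Q \<rho>)"
proof -
  obtain \<phi> p where \<phi>: "\<And>\<rho>. P \<rho> \<longleftrightarrow> sat mem \<phi> (interleave \<rho> p)"
    using assms(1) by (auto simp: definable_def)
  obtain \<psi> q where \<psi>: "\<And>\<rho>. Q \<rho> \<longleftrightarrow> sat mem \<psi> (interleave \<rho> q)"
    using assms(2) by (auto simp: definable_def)
  \<comment> \<open>Parameter number k is variable 2k+1. The merged list
    \<open>interleave p q\<close> holds \<open>p n\<close> at index 2n and \<open>q n\<close> at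
    index 2n+1, which gives the two renamings.\<close>
  let ?f = "interleave (\<lambda>n. 2 * n) (\<lambda>n. Suc (2 * (2 * n)))"
  let ?g = "interleave (\<lambda>n. 2 * n) (\<lambda>n. Suc (2 * Suc (2 * n)))"
  have inj: "inj ?f" "inj ?g"
    by (intro inj_interleave; auto simp: inj_def; presburger)+
  have "(P \<rho> \<and> Q \<rho>) \<longleftrightarrow>
      sat mem (Conj (rename_fm ?f \<phi>) (rename_fm ?g \<psi>)) (interleave \<rho> (interleave p q))" for \<rho>
    by (simp only: sat.simps sat_rename_fm inj \<phi> \<psi> comp_interleave[of "interleave _ _"] interleave_simps)
  then show ?thesis
    unfolding definable_def by blast
qed

lemma definable_all [def_intros]:
  assumes "definable (\<lambda>\<rho>. P (\<rho> 0) (\<lambda>n. \<rho> (Suc n)))"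
  shows "definable (\<lambda>\<rho>. \<forall>a. P a \<rho>)"
proof -
  obtain \<phi> p where \<phi>: "\<And>\<rho>. P (\<rho> 0) (\<lambda>n. \<rho> (Suc n)) \<longleftrightarrow> sat mem \<phi> (interleave \<rho> p)"
    using assms by (auto simp: definable_def)
  \<comment> \<open>The assignment occupies all even variables, so the quantifier binds variable 1,
    the first parameter slot. The parameters move up by one to free it, and \<open>q\<close> has a
    dummy there.\<close>
  let ?f = "interleave (case_nat (Suc (2 * 0)) (\<lambda>n. 2 * n)) (\<lambda>n. Suc (2 * Suc n))"
  define q where "q = case_nat undefined p"
  have inj: "inj ?f"
    by (intro inj_interleave) (auto simp: inj_def split: nat.splits, presburger+)
  have "(\<lambda>n. ((interleave \<rho> q)(1 := a)) (?f n)) = interleave (case_nat a \<rho>) p" for \<rho> a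
  proof -
    have "((interleave \<rho> q)(1 := a)) (case_nat (Suc (2 * 0)) (\<lambda>n. 2 * n) n) = case_nat a \<rho> n"
      "((interleave \<rho> q)(1 := a)) (Suc (2 * Suc n)) = p n" for n
      by (cases n; simp) (simp add: q_def del: mult_Suc_right)
    then show ?thesis
      by (simp only: comp_interleave[of "(interleave \<rho> q)(1 := a)"])
  qed
  then have "sat mem (All 1 (rename_fm ?f \<phi>)) (interleave \<rho> q) \<longleftrightarrow>
      (\<forall>a. sat mem \<phi> (interleave (case_nat a \<rho>) p))" for \<rho>
    by (simp only: sat.simps sat_rename_fm[OF inj])
  then show ?thesis
    unfolding definable_def \<phi>[symmetric] by (intro exI[of _ "All 1 (rename_fm ?f \<phi>)"] exI[of _ q]) simp
qed

lemma definable_iff_iff: "(\<And>\<rho>. P \<rho> \<longleftrightarrow> Q \<rho>) \<Longrightarrow> definable P \<Longrightarrow> definable Q"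
  by (simp add: definable_def)

lemma definable_disj [def_intros]:
  assumes "definable P" "definable Q"
  shows "definable (\<lambda>\<rho>. P \<rho> \<or> Q \<rho>)"
proof (rule definable_iff_iff)
  show "definable (\<lambda>\<rho>. \<not> (\<not> P \<rho> \<and> \<not> Q \<rho>))"
    by (intro def_intros assms)
qed blast

lemma definable_imp [def_intros]:
  assumes "definable P" "definable Q"
  shows "definable (\<lambda>\<rho>. P \<rho> \<longrightarrow> Q \<rho>)"
proof (rule definable_iff_iff)
  show "definable (\<lambda>\<rho>. \<not> (P \<rho> \<and> \<not> Q \<rho>))"
    by (intro def_intros assms)
qed blast

lemma definable_iff [def_intros]:
  assumes "definable P" "definable Q"
  shows "definable (\<lambda>\<rho>. P \<rho> \<longleftrightarrow> Q \<rho>)"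
proof (rule definable_iff_iff)
  show "definable (\<lambda>\<rho>. (P \<rho> \<longrightarrow> Q \<rho>) \<and> (Q \<rho> \<longrightarrow> P \<rho>))"
    by (intro def_intros assms)
qed blast

lemma definable_ex [def_intros]:
  assumes "definable (\<lambda>\<rho>. P (\<rho> 0) (\<lambda>n. \<rho> (Suc n)))"
  shows "definable (\<lambda>\<rho>. \<exists>a. P a \<rho>)"
proof (rule definable_iff_iff)
  show "\<not> (\<forall>a. \<not> P a \<rho>) \<longleftrightarrow> (\<exists>a. P a \<rho>)" for \<rho> by blast
  show "definable (\<lambda>\<rho>. \<not> (\<forall>a. \<not> P a \<rho>))"
    using assms by (intro def_intros)
qed

lemma definable_mem_var: "definable (\<lambda>\<rho>. \<rho> i \<^bold>\<in> \<rho> j)"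
  unfolding definable_def
  by (intro exI[of _ "Mem (2 * i) (2 * j)"] exI) (simp add: interleave_def)

lemma definable_eq_var: "definable (\<lambda>\<rho>. \<rho> i = \<rho> j)"
  unfolding definable_def
  by (intro exI[of _ "Eq (2 * i) (2 * j)"] exI) (simp add: interleave_def)

lemma definable_eq_const: "definable (\<lambda>\<rho>. \<rho> i = c)"
  unfolding definable_def
  by (intro exI[of _ "Eq (2 * i) 1"] exI[of _ "\<lambda>_. c"]) (simp add: interleave_def)

lemma definable_const [def_intros]: "definable (\<lambda>\<rho>. P)"
proof -
  have "definable (\<lambda>\<rho>. \<rho> 0 = \<rho> 0)" "definable (\<lambda>\<rho>. \<not> \<rho> 0 = \<rho> 0)"
    by (intro def_intros definable_eq_var)+
  then show ?thesis by (cases P) simp_all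
qed

lemma definable_term_var [def_intros]: "definable_term (\<lambda>\<rho>. \<rho> i)"
  unfolding definable_term_def by (rule definable_eq_var)

text \<open>Any element may be a parameter, so closed terms such as \<open>omega\<close> or
  \<open>cantor\<close> count as definable without unfolding their definitions.\<close>

lemma definable_term_const [def_intros]: "definable_term (\<lambda>\<rho>. c)"
  unfolding definable_term_def by (rule definable_eq_const)

lemma definable_subst:
  assumes "definable_term t" "definable (\<lambda>\<rho>. P (\<rho> 0) (\<lambda>n. \<rho> (Suc n)))"
  shows "definable (\<lambda>\<rho>. P (t \<rho>) \<rho>)"
proof (rule definable_iff_iff)
  show "(\<exists>a. a = t \<rho> \<and> P a \<rho>) \<longleftrightarrow> P (t \<rho>) \<rho>" for \<rho> by blast
  show "definable (\<lambda>\<rho>. \<exists>a. a = t \<rho> \<and> P a \<rho>)"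
    using assms by (intro def_intros) (simp_all add: definable_term_def)
qed

lemma definable_term_shift: "definable_term t \<Longrightarrow> definable_term (\<lambda>\<rho>. t (\<lambda>n. \<rho> (Suc n)))"
  unfolding definable_term_def
  by (drule definable_reindex[where f = "case_nat 0 (\<lambda>n. Suc (Suc n))"])
     (auto simp: inj_def split: nat.splits)

lemma definable_mem [def_intros]:
  assumes "definable_term t" "definable_term u"
  shows "definable (\<lambda>\<rho>. t \<rho> \<^bold>\<in> u \<rho>)"
proof (rule definable_subst[OF assms(1)])
  show "definable (\<lambda>\<rho>. \<rho> 0 \<^bold>\<in> u (\<lambda>n. \<rho> (Suc n)))"
    by (rule definable_subst[OF definable_term_shift[OF assms(2)]]) (rule definable_mem_var)
qed

lemma definable_eq [def_intros]:
  assumes "definable_term t" "definable_term u"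
  shows "definable (\<lambda>\<rho>. t \<rho> = u \<rho>)"
  by (rule definable_subst[OF assms(1)]) (use assms(2) in \<open>simp add: definable_term_def\<close>)

lemma definable_ex1 [def_intros]:
  assumes "definable (\<lambda>\<rho>. P (\<rho> 0) (\<lambda>n. \<rho> (Suc n)))"
  shows "definable (\<lambda>\<rho>. \<exists>!a. P a \<rho>)"
proof -
  \<comment> \<open>In the uniqueness clause of \<open>Ex1\<close>, variable 1 is the outer witness,
    which the remaining arguments of \<open>P\<close> must skip.\<close>
  have "definable (\<lambda>\<rho>. P (\<rho> 0) (\<lambda>n. \<rho> (Suc (Suc n))))"
    using definable_reindex[OF assms, of "case_nat 0 (\<lambda>n. Suc (Suc n))"]
    by (auto simp: inj_def split: nat.splits)
  then show ?thesis
    unfolding Ex1_def using assms by (intro def_intros)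
qed

section \<open>Comprehension terms and separation\<close>

lemma compr_eqI: "(\<And>w. P w \<longleftrightarrow> w \<^bold>\<in> z) \<Longrightarrow> compr P = z"
  unfolding compr_def by (rule the_equality) (auto intro: extensionality)

lemma compr_cong: "(\<And>w. P w \<longleftrightarrow> Q w) \<Longrightarrow> compr P = compr Q"
  by presburger

text \<open>If the class is not a set, \<open>THE\<close> is applied to the everywhere false
  predicate, and this yields one fixed element, usable as a parameter. Hence definability of a
  \<open>compr\<close> term can be settled before the existence of the set.\<close>

lemma definable_term_compr [def_intros]:
  assumes "definable (\<lambda>\<rho>. P (\<rho> 0) (\<lambda>n. \<rho> (Suc n)))"
  shows "definable_term (\<lambda>\<rho>. compr (\<lambda>w. P w \<rho>))"
  unfolding definable_term_def
proof (rule definable_iff_iff)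
  fix \<rho> :: "nat \<Rightarrow> 'v"
  let ?Q = "\<lambda>w. P w (\<lambda>n. \<rho> (Suc n))"
  show "((\<forall>w. w \<^bold>\<in> \<rho> 0 \<longleftrightarrow> ?Q w) \<or> \<not> (\<exists>z. \<forall>w. w \<^bold>\<in> z \<longleftrightarrow> ?Q w) \<and> \<rho> 0 = The (\<lambda>_. False))
      \<longleftrightarrow> \<rho> 0 = compr ?Q"
  proof (cases "\<exists>z. \<forall>w. w \<^bold>\<in> z \<longleftrightarrow> ?Q w")
    case True
    then obtain z where z: "\<forall>w. w \<^bold>\<in> z \<longleftrightarrow> ?Q w" by blast
    then have "compr ?Q = z" by (intro compr_eqI) simp
    moreover have "(\<forall>w. w \<^bold>\<in> \<rho> 0 \<longleftrightarrow> ?Q w) \<longleftrightarrow> \<rho> 0 = z"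
      using z extensionality[of "\<rho> 0" z] by blast
    ultimately show ?thesis using True by simp
  next
    case False
    then have "(\<lambda>z. \<forall>w. w \<^bold>\<in> z \<longleftrightarrow> ?Q w) = (\<lambda>_. False)" by (intro ext) simp
    then have "compr ?Q = The (\<lambda>_. False)" unfolding compr_def by (rule arg_cong)
    with False show ?thesis by (simp only: simp_thms) blast
  qed
next
  have 1: "definable (\<lambda>\<rho>. P (\<rho> 0) (\<lambda>n. \<rho> (Suc (Suc n))))"
    using definable_reindex[OF assms, of "case_nat 0 (\<lambda>n. Suc (Suc n))"]
    by (auto simp: inj_def split: nat.splits)
  have 2: "definable (\<lambda>\<rho>. P (\<rho> 0) (\<lambda>n. \<rho> (Suc (Suc (Suc n)))))"
    using definable_reindex[OF 1, of "case_nat 0 (\<lambda>n. Suc (Suc n))"]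
    by (auto simp: inj_def split: nat.splits)
  show "definable (\<lambda>\<rho>. (\<forall>w. w \<^bold>\<in> \<rho> 0 \<longleftrightarrow> P w (\<lambda>n. \<rho> (Suc n))) \<or>
      \<not> (\<exists>z. \<forall>w. w \<^bold>\<in> z \<longleftrightarrow> P w (\<lambda>n. \<rho> (Suc n))) \<and> \<rho> 0 = The (\<lambda>_. False))"
    by (intro def_intros 1 2)
qed

lemma definable_term_if [def_intros]:
  assumes "definable P" "definable_term t" "definable_term u"
  shows "definable_term (\<lambda>\<rho>. if P \<rho> then t \<rho> else u \<rho>)"
proof -
  have P: "definable (\<lambda>\<rho>. P (\<lambda>n. \<rho> (Suc n)))"
    using definable_reindex[OF assms(1), of Suc] by simp
  have "definable (\<lambda>\<rho>. (P (\<lambda>n. \<rho> (Suc n)) \<longrightarrow> \<rho> 0 = t (\<lambda>n. \<rho> (Suc n))) \<and>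
      (\<not> P (\<lambda>n. \<rho> (Suc n)) \<longrightarrow> \<rho> 0 = u (\<lambda>n. \<rho> (Suc n))))"
    by (intro def_intros P definable_term_shift assms)
  then show ?thesis
    unfolding definable_term_def by (rule definable_iff_iff[rotated]) simp
qed

lemma definable_term_subst:
  assumes "definable_term (\<lambda>\<rho>. F (\<rho> 0))" "definable_term t"
  shows "definable_term (\<lambda>\<rho>. F (t \<rho>))"
  unfolding definable_term_def
proof (rule definable_subst[OF definable_term_shift[OF assms(2)]])
  show "definable (\<lambda>\<rho>. \<rho> (Suc 0) = F (\<rho> 0))"
    by (intro def_intros assms(1))
qed

lemma definable_subst1:
  assumes "definable (\<lambda>\<rho>. P (\<rho> 0))" "definable_term t"
  shows "definable (\<lambda>\<rho>. P (t \<rho>))"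
  by (rule definable_subst[OF assms(2,1)])

lemma definable_term_subst2:
  assumes "definable_term (\<lambda>\<rho>. F (\<rho> 0) (\<rho> 1))" "definable_term t" "definable_term u"
  shows "definable_term (\<lambda>\<rho>. F (t \<rho>) (u \<rho>))"
  unfolding definable_term_def
proof (rule definable_subst[OF definable_term_shift[OF assms(2)]],
       rule definable_subst[OF definable_term_shift[OF definable_term_shift[OF assms(3)]]])
  \<comment> \<open>The graph of \<open>F\<close> has its value in variable 0 and its arguments in 1
    and 2. The two substitutions leave \<open>u\<close> in 0, \<open>t\<close> in 1 and the value in
    2, so the renaming swaps 0 and 2.\<close>
  from definable_reindex[OF assms(1)[unfolded definable_term_def], of "case_nat 2 (case_nat 1 (\<lambda>n. case n of 0 \<Rightarrow> 0 | Suc n \<Rightarrow> Suc (Suc (Suc n))))"]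
  show "definable (\<lambda>\<rho>. \<rho> (Suc (Suc 0)) = F (\<rho> (Suc 0)) (\<rho> 0))"
    by (auto simp: inj_def numeral_2_eq_2 split: nat.splits)
qed

text \<open>The form in which separation is applied: definability supplies the formula and
  \<open>B\<close> the set to separate from. Whatever \<open>P\<close> mentions besides its argument
  is a parameter.\<close>

theorem mem_compr:
  assumes "definable (\<lambda>\<rho>. P (\<rho> 0))" "\<And>w. P w \<Longrightarrow> w \<^bold>\<in> B"
  shows "w \<^bold>\<in> compr P \<longleftrightarrow> P w"
proof -
  obtain \<phi> p where \<phi>: "\<And>\<rho>. P (\<rho> 0) \<longleftrightarrow> sat mem \<phi> (interleave \<rho> p)"
    using assms by (auto simp: definable_def)
  obtain z where z: "\<forall>x. x \<^bold>\<in> z \<longleftrightarrow> x \<^bold>\<in> B \<and> sat mem \<phi> ((interleave (\<lambda>_. B) p)(0 := x))"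
    using separation[of B \<phi> "interleave (\<lambda>_. B) p"] by blast
  have "x \<^bold>\<in> z \<longleftrightarrow> P x" for x
    using z assms(2) \<phi>[of "(\<lambda>_. B)(0 := x)"] by (auto simp: interleave_fun_upd)
  then have "compr P = z" by (intro compr_eqI) simp
  with \<open>\<And>x. x \<^bold>\<in> z \<longleftrightarrow> P x\<close> show ?thesis by simp
qed

section \<open>Pairs, functions and the natural numbers of the model\<close>

lemma mem_compr_ex: "\<exists>z. \<forall>w. w \<^bold>\<in> z \<longleftrightarrow> P w \<Longrightarrow> w \<^bold>\<in> compr P \<longleftrightarrow> P w"
  using compr_eqI[of P] by metis

lemma mem_upair [simp]: "w \<^bold>\<in> upair x y \<longleftrightarrow> w = x \<or> w = y"
  unfolding upair_def by (rule mem_compr_ex) (rule pairing)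

lemma definable_upair [def_intros]:
  "definable_term t \<Longrightarrow> definable_term u \<Longrightarrow> definable_term (\<lambda>\<rho>. upair (t \<rho>) (u \<rho>))"
  by (rule definable_term_subst2[where F = upair]) (unfold upair_def, intro def_intros)

lemma definable_opair [def_intros]:
  "definable_term t \<Longrightarrow> definable_term u \<Longrightarrow> definable_term (\<lambda>\<rho>. opair (t \<rho>) (u \<rho>))"
  unfolding opair_def by (intro def_intros)

lemma opair_eq [simp]: "opair x y = opair x' y' \<longleftrightarrow> x = x' \<and> y = y'"
proof -
  have "upair a b = upair c d \<Longrightarrow> (a = c \<or> a = d) \<and> (b = c \<or> b = d) \<and> (c = a \<or> c = b) \<and> (d = a \<or> d = b)"
    for a b c d
    by (metis mem_upair)
  from this[of "upair x x" "upair x y" "upair x' x'" "upair x' y'"]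
    this[of x x x' x'] this[of x x x' y'] this[of x y x' x'] this[of x y x' y']
  show ?thesis unfolding opair_def by metis
qed

text \<open>A Kuratowski pair is a set of subsets of the union of \<open>A\<close> and
  \<open>B\<close>, so the double power set of that union contains all pairs.\<close>

lemma ex_prod_bound: "\<exists>z. \<forall>x y. x \<^bold>\<in> A \<longrightarrow> y \<^bold>\<in> B \<longrightarrow> opair x y \<^bold>\<in> z"
proof -
  obtain u where u: "\<forall>w. w \<^bold>\<in> u \<longleftrightarrow> (\<exists>y. y \<^bold>\<in> upair A B \<and> w \<^bold>\<in> y)"
    using union by blast
  obtain p where p: "\<forall>y. y \<^bold>\<in> p \<longleftrightarrow> (\<forall>w. w \<^bold>\<in> y \<longrightarrow> w \<^bold>\<in> u)"
    using powerset by blast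
  obtain q where q: "\<forall>y. y \<^bold>\<in> q \<longleftrightarrow> (\<forall>w. w \<^bold>\<in> y \<longrightarrow> w \<^bold>\<in> p)"
    using powerset by blast
  show ?thesis
    by (rule exI[of _ q]) (auto simp: opair_def q p u)
qed

lemma mem_prod_set: "p \<^bold>\<in> prod_set A B \<longleftrightarrow> (\<exists>x y. x \<^bold>\<in> A \<and> y \<^bold>\<in> B \<and> p = opair x y)"
proof -
  obtain z where z: "\<forall>x y. x \<^bold>\<in> A \<longrightarrow> y \<^bold>\<in> B \<longrightarrow> opair x y \<^bold>\<in> z"
    using ex_prod_bound by blast
  show ?thesis
    unfolding prod_set_def
    by (rule mem_compr[where B = z]) (intro def_intros, use z in blast)
qed

lemma opair_mem_prod_set [simp]: "opair x y \<^bold>\<in> prod_set A B \<longleftrightarrow> x \<^bold>\<in> A \<and> y \<^bold>\<in> B"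
  by (auto simp: mem_prod_set)

lemma definable_prod_set [def_intros]:
  "definable_term t \<Longrightarrow> definable_term u \<Longrightarrow> definable_term (\<lambda>\<rho>. prod_set (t \<rho>) (u \<rho>))"
  by (rule definable_term_subst2[where F = prod_set]) (unfold prod_set_def, intro def_intros)

lemma mem_dom: "x \<^bold>\<in> dom f \<longleftrightarrow> (\<exists>y. opair x y \<^bold>\<in> f)"
proof -
  \<comment> \<open>A first coordinate is an element of an element of a pair in \<open>f\<close>, so
    it lies in the double union of \<open>f\<close>.\<close>
  obtain u where u: "\<forall>w. w \<^bold>\<in> u \<longleftrightarrow> (\<exists>y. y \<^bold>\<in> f \<and> w \<^bold>\<in> y)"
    using union by blast
  obtain v where v: "\<forall>w. w \<^bold>\<in> v \<longleftrightarrow> (\<exists>y. y \<^bold>\<in> u \<and> w \<^bold>\<in> y)"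
    using union by blast
  have "upair x x \<^bold>\<in> opair x y" "x \<^bold>\<in> upair x x" for x y
    by (simp_all add: opair_def)
  then have "opair x y \<^bold>\<in> f \<Longrightarrow> x \<^bold>\<in> v" for x y
    using u v by blast
  then show ?thesis
    unfolding dom_def by (intro mem_compr[where B = v] def_intros) auto
qed

lemma definable_dom [def_intros]: "definable_term t \<Longrightarrow> definable_term (\<lambda>\<rho>. dom (t \<rho>))"
  by (rule definable_term_subst[where F = dom]) (unfold dom_def, intro def_intros)

lemma definable_subset [def_intros]:
  "definable_term t \<Longrightarrow> definable_term u \<Longrightarrow> definable (\<lambda>\<rho>. t \<rho> \<^bold>\<subseteq> u \<rho>)"
  by (rule definable_subst, assumption, rule definable_subst, erule definable_term_shift)
     (unfold subset_def, intro def_intros)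

lemma definable_funs [def_intros]:
  "definable_term t \<Longrightarrow> definable_term u \<Longrightarrow> definable_term (\<lambda>\<rho>. funs (t \<rho>) (u \<rho>))"
  by (rule definable_term_subst2[where F = funs]) (unfold funs_def, intro def_intros)

lemma mem_funs:
  "f \<^bold>\<in> funs A B \<longleftrightarrow> f \<^bold>\<subseteq> prod_set A B \<and> (\<forall>x. x \<^bold>\<in> A \<longrightarrow> (\<exists>!y. opair x y \<^bold>\<in> f))"
proof -
  obtain q where "\<forall>y. y \<^bold>\<in> q \<longleftrightarrow> (\<forall>w. w \<^bold>\<in> y \<longrightarrow> w \<^bold>\<in> prod_set A B)"
    using powerset by blast
  then show ?thesis
    unfolding funs_def by (intro mem_compr[where B = q] def_intros) (auto simp: subset_def)
qed

text \<open>
  The value of \<open>app\<close> is arbitrary where the function is not single-valued, and then it is not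
  definable.  \<open>ap\<close> agrees with it on functions and is definable throughout.
\<close>

definition ap :: "'v \<Rightarrow> 'v \<Rightarrow> 'v" where
  "ap f x = compr (\<lambda>w. \<exists>y. opair x y \<^bold>\<in> f \<and> w \<^bold>\<in> y)"

lemma definable_ap [def_intros]:
  "definable_term t \<Longrightarrow> definable_term u \<Longrightarrow> definable_term (\<lambda>\<rho>. ap (t \<rho>) (u \<rho>))"
  by (rule definable_term_subst2[where F = ap]) (unfold ap_def, intro def_intros)

lemma ap_eqI:
  assumes "opair x y \<^bold>\<in> f" "\<And>z. opair x z \<^bold>\<in> f \<Longrightarrow> z = y"
  shows "ap f x = y" "app f x = y"
proof -
  show "ap f x = y"
    unfolding ap_def using assms by (intro compr_eqI) blast
  show "app f x = y"
    unfolding app_def using assms by (intro the_equality)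
qed

lemma funs_opair:
  assumes "f \<^bold>\<in> funs A B"
  shows "opair x y \<^bold>\<in> f \<longleftrightarrow> x \<^bold>\<in> A \<and> y = ap f x"
proof (cases "x \<^bold>\<in> A")
  case True
  then obtain z where z: "opair x z \<^bold>\<in> f" "\<And>w. opair x w \<^bold>\<in> f \<Longrightarrow> w = z"
    using assms unfolding mem_funs by metis
  with True show ?thesis
    using ap_eqI(1)[OF z] by metis
next
  case False
  moreover have "opair x y \<^bold>\<in> f \<Longrightarrow> opair x y \<^bold>\<in> prod_set A B"
    using assms unfolding mem_funs subset_def by blast
  ultimately show ?thesis by auto
qed

lemma funs_mem:
  assumes "f \<^bold>\<in> funs A B"
  shows "p \<^bold>\<in> f \<longleftrightarrow> (\<exists>x. x \<^bold>\<in> A \<and> p = opair x (ap f x))"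
proof
  assume "p \<^bold>\<in> f"
  then obtain x y where "p = opair x y"
    using assms by (auto simp: mem_funs subset_def mem_prod_set)
  with \<open>p \<^bold>\<in> f\<close> show "\<exists>x. x \<^bold>\<in> A \<and> p = opair x (ap f x)"
    using funs_opair[OF assms] by auto
qed (use funs_opair[OF assms] in auto)

lemma app_eq_ap: "f \<^bold>\<in> funs A B \<Longrightarrow> x \<^bold>\<in> A \<Longrightarrow> app f x = ap f x"
  by (rule ap_eqI) (auto simp: funs_opair)

lemma ap_type: "f \<^bold>\<in> funs A B \<Longrightarrow> x \<^bold>\<in> A \<Longrightarrow> ap f x \<^bold>\<in> B"
  using funs_opair[of f A B x "ap f x"] opair_mem_prod_set[of x "ap f x" A B]
  unfolding mem_funs subset_def by blast

lemma funs_dom: "f \<^bold>\<in> funs A B \<Longrightarrow> dom f = A"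
  by (rule extensionality) (auto simp: mem_dom funs_opair)

lemma funs_ext:
  "f \<^bold>\<in> funs A B \<Longrightarrow> g \<^bold>\<in> funs A C \<Longrightarrow> (\<And>x. x \<^bold>\<in> A \<Longrightarrow> ap f x = ap g x) \<Longrightarrow> f = g"
  by (rule extensionality) (auto simp: funs_mem)

lemma funs_graph:
  assumes "\<And>p. p \<^bold>\<in> f \<longleftrightarrow> (\<exists>x. x \<^bold>\<in> A \<and> p = opair x (F x))" "\<And>x. x \<^bold>\<in> A \<Longrightarrow> F x \<^bold>\<in> B"
  shows "f \<^bold>\<in> funs A B" "\<And>x. x \<^bold>\<in> A \<Longrightarrow> ap f x = F x"
proof -
  show "f \<^bold>\<in> funs A B"
    using assms by (auto simp: mem_funs subset_def mem_prod_set)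
  show "ap f x = F x" if "x \<^bold>\<in> A" for x
    using that assms(1) by (intro ap_eqI) auto
qed

definition lam :: "'v \<Rightarrow> ('v \<Rightarrow> 'v) \<Rightarrow> 'v" where
  "lam A F = compr (\<lambda>p. \<exists>x. x \<^bold>\<in> A \<and> p = opair x (F x))"

lemma lam:
  assumes "definable_term (\<lambda>\<rho>. F (\<rho> 0))" "\<And>x. x \<^bold>\<in> A \<Longrightarrow> F x \<^bold>\<in> B"
  shows "lam A F \<^bold>\<in> funs A B" "\<And>x. x \<^bold>\<in> A \<Longrightarrow> ap (lam A F) x = F x"
proof -
  have *: "p \<^bold>\<in> lam A F \<longleftrightarrow> (\<exists>x. x \<^bold>\<in> A \<and> p = opair x (F x))" for p
    unfolding lam_def
    by (intro mem_compr[where B = "prod_set A B"] def_intros assms(1)) (use assms(2) in auto)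
  show "lam A F \<^bold>\<in> funs A B" "\<And>x. x \<^bold>\<in> A \<Longrightarrow> ap (lam A F) x = F x"
    using funs_graph[OF * assms(2)] by auto
qed

lemma mem_restr: "p \<^bold>\<in> restr f A \<longleftrightarrow> p \<^bold>\<in> f \<and> (\<exists>x y. x \<^bold>\<in> A \<and> p = opair x y)"
  unfolding restr_def by (intro mem_compr[where B = f] def_intros) auto

lemma definable_restr [def_intros]:
  "definable_term t \<Longrightarrow> definable_term u \<Longrightarrow> definable_term (\<lambda>\<rho>. restr (t \<rho>) (u \<rho>))"
  by (rule definable_term_subst2[where F = restr]) (unfold restr_def, intro def_intros)

lemma restr_funs:
  assumes "f \<^bold>\<in> funs A B" "\<And>w. w \<^bold>\<in> C \<Longrightarrow> w \<^bold>\<in> A"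
  shows "restr f C \<^bold>\<in> funs C B" "\<And>x. x \<^bold>\<in> C \<Longrightarrow> ap (restr f C) x = ap f x"
proof -
  have *: "p \<^bold>\<in> restr f C \<longleftrightarrow> (\<exists>x. x \<^bold>\<in> C \<and> p = opair x (ap f x))" for p
    using assms(2) by (auto simp: mem_restr funs_mem[OF assms(1)])
  show "restr f C \<^bold>\<in> funs C B" "\<And>x. x \<^bold>\<in> C \<Longrightarrow> ap (restr f C) x = ap f x"
    using funs_graph[OF *, of B] assms ap_type[OF assms(1)] by auto
qed

section \<open>The empty set, successors and omega\<close>

lemma not_mem_empty [simp]: "\<not> w \<^bold>\<in> zero"
proof -
  have "w \<^bold>\<in> zero \<longleftrightarrow> False"
    unfolding empty_def
    by (rule mem_compr_ex) (use infinity in blast)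
  then show ?thesis by simp
qed

lemma eq_empty: "x = zero \<longleftrightarrow> (\<forall>w. \<not> w \<^bold>\<in> x)"
  using extensionality[of x zero] by auto

lemma mem_succ [simp]: "w \<^bold>\<in> succ x \<longleftrightarrow> w \<^bold>\<in> x \<or> w = x"
proof -
  obtain u where u: "\<forall>w. w \<^bold>\<in> u \<longleftrightarrow> (\<exists>y. y \<^bold>\<in> upair x (upair x x) \<and> w \<^bold>\<in> y)"
    using union by blast
  show ?thesis
    unfolding succ_def by (rule mem_compr_ex, rule exI[of _ u]) (use u in auto)
qed

lemma definable_succ [def_intros]: "definable_term t \<Longrightarrow> definable_term (\<lambda>\<rho>. succ (t \<rho>))"
  by (rule definable_term_subst[where F = succ]) (unfold succ_def, intro def_intros)

lemma not_mem_self [simp]: "\<not> x \<^bold>\<in> x"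
  using foundation[of "upair x x"] by auto

lemma not_mem_cycle: "x \<^bold>\<in> y \<Longrightarrow> \<not> y \<^bold>\<in> x"
  using foundation[of "upair x y"] by auto

lemma succ_eq [simp]: "succ x = succ y \<longleftrightarrow> x = y"
  using not_mem_cycle by (metis mem_succ)

lemma succ_neq_zero [simp]: "succ x \<noteq> zero" "zero \<noteq> succ x"
  by (metis mem_succ not_mem_empty)+

lemma mem_omega: "n \<^bold>\<in> omega \<longleftrightarrow> (\<forall>I. is_inductive I \<longrightarrow> n \<^bold>\<in> I)"
proof -
  obtain I where "(\<exists>e. e \<^bold>\<in> I \<and> (\<forall>w. \<not> w \<^bold>\<in> e)) \<and>
        (\<forall>x. x \<^bold>\<in> I \<longrightarrow> (\<exists>s. s \<^bold>\<in> I \<and> (\<forall>w. w \<^bold>\<in> s \<longleftrightarrow> w \<^bold>\<in> x \<or> w = x)))"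
    using infinity by blast
  moreover have "(\<forall>w. w \<^bold>\<in> s \<longleftrightarrow> w \<^bold>\<in> x \<or> w = x) \<Longrightarrow> s = succ x" for s x
    by (rule extensionality) simp
  ultimately have "is_inductive I"
    unfolding is_inductive_def eq_empty[symmetric] by blast
  then show ?thesis
    unfolding omega_def is_inductive_def
    by (intro mem_compr[where B = I] def_intros) (auto simp: is_inductive_def)
qed

lemma zero_omega [simp]: "zero \<^bold>\<in> omega"
  by (simp add: mem_omega is_inductive_def)

lemma succ_omega [simp]: "n \<^bold>\<in> omega \<Longrightarrow> succ n \<^bold>\<in> omega"
  by (simp add: mem_omega is_inductive_def)

text \<open>By definability the numbers satisfying \<open>P\<close> form a set of the model; this
  set is inductive and hence contains \<open>omega\<close>.\<close>

lemma omega_induct [consumes 1, case_names definable zero succ]: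
  assumes "n \<^bold>\<in> omega" "definable (\<lambda>\<rho>. P (\<rho> 0))"
    and "P zero" "\<And>n. n \<^bold>\<in> omega \<Longrightarrow> P n \<Longrightarrow> P (succ n)"
  shows "P n"
proof -
  have *: "n \<^bold>\<in> compr (\<lambda>n. n \<^bold>\<in> omega \<and> P n) \<longleftrightarrow> n \<^bold>\<in> omega \<and> P n" for n
    by (intro mem_compr[where B = omega] def_intros assms(2)) auto
  then have "is_inductive (compr (\<lambda>n. n \<^bold>\<in> omega \<and> P n))"
    using assms by (simp add: is_inductive_def)
  then show ?thesis
    using assms(1) * by (auto simp: mem_omega)
qed

lemma omega_cases:
  assumes "n \<^bold>\<in> omega"
  obtains "n = zero" | m where "m \<^bold>\<in> omega" "n = succ m"
proof -
  have "n = zero \<or> (\<exists>m. m \<^bold>\<in> omega \<and> n = succ m)"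
    using assms
  proof (induction rule: omega_induct)
    case definable
    show ?case by (intro def_intros)
  qed auto
  then show ?thesis using that by blast
qed

lemma omega_trans: "n \<^bold>\<in> omega \<Longrightarrow> m \<^bold>\<in> n \<Longrightarrow> m \<^bold>\<in> omega"
proof (induction rule: omega_induct)
  case definable
  show ?case by (intro def_intros)
qed auto

lemma mem_trans: "n \<^bold>\<in> omega \<Longrightarrow> m \<^bold>\<in> n \<Longrightarrow> k \<^bold>\<in> m \<Longrightarrow> k \<^bold>\<in> n"
proof (induction rule: omega_induct)
  case definable
  show ?case by (intro def_intros)
qed auto

lemma zero_mem_succ: "n \<^bold>\<in> omega \<Longrightarrow> zero \<^bold>\<in> succ n"
proof (induction rule: omega_induct)
  case definable
  show ?case by (intro def_intros)
qed auto

lemma succ_mem_succ: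
  assumes "n \<^bold>\<in> omega"
  shows "succ m \<^bold>\<in> succ n \<longleftrightarrow> m \<^bold>\<in> n"
proof
  assume "succ m \<^bold>\<in> succ n"
  then show "m \<^bold>\<in> n"
    using assms mem_trans[of n "succ m" m] by auto
next
  show "m \<^bold>\<in> n \<Longrightarrow> succ m \<^bold>\<in> succ n"
    using assms
  proof (induction rule: omega_induct)
    case definable
    show ?case by (intro def_intros)
  qed auto
qed

lemma omega_linear:
  assumes "m \<^bold>\<in> omega" "n \<^bold>\<in> omega"
  shows "m \<^bold>\<in> n \<or> m = n \<or> n \<^bold>\<in> m"
  using assms(2)
proof (induction rule: omega_induct)
  case definable
  show ?case by (intro def_intros)
next
  case zero
  show ?case using zero_mem_succ[of m] assms(1) by (auto elim: omega_cases)
next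
  case (succ n)
  then show ?case
    using succ_mem_succ[OF assms(1), of n] by auto
qed

section \<open>Recursion and parity\<close>

text \<open>Course-of-values recursion: \<open>G\<close> sees the whole sequence so far, as a
  strategy does. Every \<open>k\<close> has exactly one approximation of length \<open>k\<close>,
  and the value of \<open>y\<close> at \<open>k\<close> is \<open>G\<close> of it.\<close>

theorem recursion:
  assumes G: "definable_term (\<lambda>\<rho>. G (\<rho> 0))" "\<And>s. G s \<^bold>\<in> B"
  obtains y where "y \<^bold>\<in> funs omega B" "\<And>k. k \<^bold>\<in> omega \<Longrightarrow> ap y k = G (restr y k)"
proof -
  define approx where
    "approx h k \<longleftrightarrow> h \<^bold>\<in> funs k B \<and> (\<forall>i. i \<^bold>\<in> k \<longrightarrow> ap h i = G (restr h i))" for h k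
  \<comment> \<open>By uniqueness the union of all approximations of length \<open>k\<close> is the
    approximation itself. Written as a \<open>compr\<close>, it is a definable term in
    \<open>k\<close>.\<close>
  define H where "H k = compr (\<lambda>w. \<exists>h. approx h k \<and> w \<^bold>\<in> h)" for k
  have defG: "definable_term t \<Longrightarrow> definable_term (\<lambda>\<rho>. G (t \<rho>))" for t
    by (rule definable_term_subst[OF G(1)])
  have approx_restr: "approx (restr h i) i" if "approx h k" "k \<^bold>\<in> omega" "i \<^bold>\<in> succ k" for h i k
  proof -
    have h: "h \<^bold>\<in> funs k B" using that by (simp add: approx_def)
    have sub: "w \<^bold>\<in> i \<Longrightarrow> w \<^bold>\<in> k" for w
      using that mem_trans[of k i w] by auto
    have "restr (restr h i) j = restr h j" if "j \<^bold>\<in> i" for j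
    proof -
      have "w \<^bold>\<in> j \<Longrightarrow> w \<^bold>\<in> i" for w
        using that \<open>k \<^bold>\<in> omega\<close> \<open>i \<^bold>\<in> succ k\<close> omega_trans[of "succ k" i] mem_trans[of i j w] by simp
      then show ?thesis by (intro extensionality) (auto simp: mem_restr)
    qed
    then show ?thesis
      using that restr_funs[OF h sub] sub unfolding approx_def by simp
  qed
  have ex: "\<exists>h. approx h k" if "k \<^bold>\<in> omega" for k
    using that
  proof (induction rule: omega_induct)
    case definable
    show ?case unfolding approx_def by (intro def_intros defG)
  next
    case zero
    have "approx zero zero"
      by (simp add: approx_def mem_funs subset_def)
    then show ?case ..
  next
    case (succ k)
    then obtain h where h: "approx h k" by blast
    then have hf: "h \<^bold>\<in> funs k B" by (simp add: approx_def)
    define h' where "h' = lam (succ k) (\<lambda>x. if x = k then G h else ap h x)"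
    have h': "h' \<^bold>\<in> funs (succ k) B" "\<And>x. x \<^bold>\<in> succ k \<Longrightarrow> ap h' x = (if x = k then G h else ap h x)"
      unfolding h'_def
      by (rule lam; (intro def_intros)?; use G(2) ap_type[OF hf] in auto)+
    have "restr h' k = h"
      by (rule funs_ext[OF restr_funs(1)[OF h'(1)] hf]) (auto simp: restr_funs(2)[OF h'(1)] h'(2))
    moreover have "restr h' i = restr h i" if "i \<^bold>\<in> k" for i
    proof -
      have sub: "w \<^bold>\<in> i \<Longrightarrow> w \<^bold>\<in> k" "w \<^bold>\<in> i \<Longrightarrow> w \<^bold>\<in> succ k" for w
        using mem_trans[OF succ(1) that] by auto
      note r = restr_funs[where C = i, OF h'(1)] restr_funs[where C = i, OF hf]
      have "ap h' x = ap h x" if "x \<^bold>\<in> i" for x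
        using h'(2)[of x] sub[OF that] by auto
      then show ?thesis
        by (intro funs_ext[OF r(1,3)]) (simp_all add: r(2,4) sub)
    qed
    ultimately have "approx h' (succ k)"
      using h' h by (auto simp: approx_def)
    then show ?case ..
  qed
  have "\<forall>h h'. approx h k \<and> approx h' k \<longrightarrow> h = h'" if "k \<^bold>\<in> omega" for k
    using that
  proof (induction rule: omega_induct)
    case definable
    show ?case unfolding approx_def by (intro def_intros defG)
  next
    case zero
    show ?case by (auto simp: approx_def intro: funs_ext)
  next
    case (succ k)
    show ?case
    proof (intro allI impI)
      fix h h' assume "approx h (succ k) \<and> approx h' (succ k)"
      then have h: "approx h (succ k)" "approx h' (succ k)" by auto
      then have f: "h \<^bold>\<in> funs (succ k) B" "h' \<^bold>\<in> funs (succ k) B"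
        by (simp_all add: approx_def)
      have eq: "restr h k = restr h' k"
        using succ approx_restr[OF h(1), of k] approx_restr[OF h(2), of k] by auto
      have "ap h i = ap h' i" if "i \<^bold>\<in> k" for i
        using arg_cong[OF eq, of "\<lambda>f. ap f i"] that
        by (simp add: restr_funs(2)[OF f(1)] restr_funs(2)[OF f(2)])
      moreover have "ap h k = ap h' k"
        using h eq by (simp add: approx_def)
      ultimately show "h = h'"
        by (intro funs_ext[OF f]) auto
    qed
  qed
  then have H: "H k = h" if "approx h k" "k \<^bold>\<in> omega" for h k
    unfolding H_def using that by (intro compr_eqI) blast
  define y where "y = lam omega (\<lambda>i. G (H i))"
  have y: "y \<^bold>\<in> funs omega B" "\<And>i. i \<^bold>\<in> omega \<Longrightarrow> ap y i = G (H i)"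
    unfolding y_def H_def approx_def
    by (rule lam; (intro def_intros defG)?; use G(2) in simp)+
  moreover have "ap y k = G (restr y k)" if k: "k \<^bold>\<in> omega" for k
  proof -
    have Hk: "approx (H k) k"
      using ex[OF k] H[OF _ k] by auto
    then have Hf: "H k \<^bold>\<in> funs k B" by (simp add: approx_def)
    have "restr y k = H k"
    proof (rule funs_ext[OF restr_funs(1)[OF y(1)] Hf])
      fix i assume i: "i \<^bold>\<in> k"
      have "H i = restr (H k) i"
        using approx_restr[OF Hk k] i omega_trans[OF k i] by (intro H) auto
      then show "ap (restr y k) i = ap (H k) i"
        using i Hk omega_trans[OF k] by (simp add: restr_funs(2)[OF y(1)] y(2) approx_def)
    qed (use omega_trans[OF k] in auto)
    then show ?thesis using y k by simp
  qed
  ultimately show ?thesis using that by blast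
qed

lemma restr_zero [simp]: "restr f zero = zero"
  by (simp add: eq_empty mem_restr)

lemma restr_succ_neq_zero:
  assumes "y \<^bold>\<in> funs omega B" "i \<^bold>\<in> omega"
  shows "restr y (succ i) \<noteq> zero"
  using assms funs_opair[OF assms(1), of i "ap y i"] by (auto simp: eq_empty mem_restr)

lemma restr_finseqs:
  assumes "y \<^bold>\<in> funs omega B" "k \<^bold>\<in> omega"
  shows "restr y k \<^bold>\<in> funs k B" "dom (restr y k) = k" "\<And>x. x \<^bold>\<in> k \<Longrightarrow> ap (restr y k) x = ap y x"
proof -
  show *: "restr y k \<^bold>\<in> funs k B"
    by (rule restr_funs(1)[OF assms(1) omega_trans[OF assms(2)]])
  show "dom (restr y k) = k"
    by (rule funs_dom[OF *])
  show "ap (restr y k) x = ap y x" if "x \<^bold>\<in> k" for x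
    using that by (intro restr_funs(2)[OF assms(1) omega_trans[OF assms(2)]])
qed

lemma iteration:
  assumes F: "definable_term (\<lambda>\<rho>. F (\<rho> 0))" "\<And>x. x \<^bold>\<in> B \<Longrightarrow> F x \<^bold>\<in> B" and a: "a \<^bold>\<in> B"
  obtains g where "g \<^bold>\<in> funs omega B" "ap g zero = a" "\<And>i. i \<^bold>\<in> omega \<Longrightarrow> ap g (succ i) = F (ap g i)"
proof -
  \<comment> \<open>The union of the number \<open>succ i\<close> is \<open>i\<close>, the index of
    the last entry of a sequence of that length.\<close>
  define last where "last s = compr (\<lambda>w. \<exists>v. v \<^bold>\<in> dom s \<and> w \<^bold>\<in> v)" for s
  \<comment> \<open>\<open>recursion\<close> demands values in \<open>B\<close> at every argument,
    even one that is no sequence over \<open>B\<close>; the membership test with default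
    \<open>a\<close> ensures this.\<close>
  define G where "G s = (if s = zero then a else if ap s (last s) \<^bold>\<in> B then F (ap s (last s)) else a)" for s
  have defF: "definable_term t \<Longrightarrow> definable_term (\<lambda>\<rho>. F (t \<rho>))" for t
    by (rule definable_term_subst[OF F(1)])
  obtain g where g: "g \<^bold>\<in> funs omega B" "\<And>k. k \<^bold>\<in> omega \<Longrightarrow> ap g k = G (restr g k)"
  proof (rule recursion)
    show "definable_term (\<lambda>\<rho>. G (\<rho> 0))"
      unfolding G_def last_def by (intro def_intros defF)
    show "G s \<^bold>\<in> B" for s using F(2) a by (simp add: G_def)
  qed blast
  have "ap g (succ i) = F (ap g i)" if "i \<^bold>\<in> omega" for i
  proof -
    have "last (restr g (succ i)) = i"
      unfolding last_def restr_finseqs(2)[OF g(1) succ_omega[OF that]]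
      by (rule compr_eqI) (use mem_trans[OF that] in auto)
    then show ?thesis
      using g(2)[of "succ i"] that restr_succ_neq_zero[OF g(1) that] ap_type[OF g(1) that]
      by (simp add: G_def restr_finseqs(3)[OF g(1) succ_omega[OF that]])
  qed
  moreover have "ap g zero = a" using g(2)[of zero] by (simp add: G_def)
  ultimately show ?thesis using g(1) that by blast
qed

section \<open>Addition and parity\<close>

definition adder :: "'v \<Rightarrow> 'v \<Rightarrow> bool" where
  "adder m g \<longleftrightarrow> g \<^bold>\<in> funs omega omega \<and> ap g zero = m \<and>
     (\<forall>i. i \<^bold>\<in> omega \<longrightarrow> ap g (succ i) = succ (ap g i))"

lemma ex_adder: "m \<^bold>\<in> omega \<Longrightarrow> \<exists>g. adder m g"
  unfolding adder_def
  by (rule iteration[of succ omega m]) (intro def_intros, auto)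

lemma adder_unique: "adder m g \<Longrightarrow> adder m g' \<Longrightarrow> g = g'"
proof (rule funs_ext)
  fix n assume *: "adder m g" "adder m g'" and "n \<^bold>\<in> omega"
  from this(3) show "ap g n = ap g' n"
  proof (induction rule: omega_induct)
    case definable
    show ?case by (intro def_intros)
  qed (use * in \<open>auto simp: adder_def\<close>)
qed (auto simp: adder_def)

text \<open>\<open>add\<close> is a description through \<open>app\<close>, which has no
  definability rule. An adder is a set and can be a parameter, so inductions about sums run on
  \<open>ap g n\<close> instead.\<close>

lemma add_eq:
  assumes "adder m g" "n \<^bold>\<in> omega"
  shows "add m n = ap g n"
proof -
  have "(h \<^bold>\<in> funs omega omega \<and> app h zero = m \<and>
     (\<forall>i. i \<^bold>\<in> omega \<longrightarrow> app h (succ i) = succ (app h i)) \<and> k = app h n) \<longleftrightarrow>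
     adder m h \<and> k = ap h n" for h k
    using assms(2) by (auto simp: adder_def app_eq_ap)
  then show ?thesis
    unfolding add_def using assms(1) by (auto intro!: the_equality dest: adder_unique[OF assms(1)])
qed

lemma
  assumes "m \<^bold>\<in> omega"
  shows add_zero [simp]: "add m zero = m"
    and add_succ [simp]: "n \<^bold>\<in> omega \<Longrightarrow> add m (succ n) = succ (add m n)"
    and add_omega [simp]: "n \<^bold>\<in> omega \<Longrightarrow> add m n \<^bold>\<in> omega"
proof -
  obtain g where g: "adder m g" using ex_adder[OF assms] ..
  then show "add m zero = m" by (simp add: add_eq[OF g]) (simp add: adder_def)
  show "add m (succ n) = succ (add m n)" "add m n \<^bold>\<in> omega" if "n \<^bold>\<in> omega"
    using g that by (simp_all add: add_eq[OF g]) (auto simp: adder_def ap_type)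
qed

lemma add_zero_left [simp]:
  assumes "n \<^bold>\<in> omega"
  shows "add zero n = n"
proof -
  obtain g where g: "adder zero g" using ex_adder[OF zero_omega] ..
  have "ap g n = n" using assms
  proof (induction rule: omega_induct)
    case definable
    show ?case by (intro def_intros)
  qed (use g in \<open>auto simp: adder_def\<close>)
  then show ?thesis using assms by (simp add: add_eq[OF g])
qed

lemma add_succ_left [simp]:
  assumes "m \<^bold>\<in> omega" "n \<^bold>\<in> omega"
  shows "add (succ m) n = succ (add m n)"
proof -
  obtain g h where gh: "adder m g" "adder (succ m) h"
    using ex_adder assms(1) succ_omega by blast
  have "ap h n = succ (ap g n)" using assms(2)
  proof (induction rule: omega_induct)
    case definable
    show ?case by (intro def_intros)
  qed (use gh in \<open>auto simp: adder_def\<close>)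
  then show ?thesis using assms by (simp add: add_eq[OF gh(1)] add_eq[OF gh(2)])
qed

definition evn :: "'v \<Rightarrow> bool" where
  "evn m \<longleftrightarrow> (\<exists>k. k \<^bold>\<in> omega \<and> m = add k k)"

lemma definable_evn [def_intros]:
  assumes "definable_term t"
  shows "definable (\<lambda>\<rho>. evn (t \<rho>))"
proof (rule definable_subst1[OF _ assms])
  \<comment> \<open>Quantifying over the adder replaces \<open>add\<close> by definable
    vocabulary.\<close>
  have "(\<exists>k g. k \<^bold>\<in> omega \<and> adder k g \<and> m = ap g k) \<longleftrightarrow> evn m" for m
    unfolding evn_def using ex_adder add_eq by metis
  then show "definable (\<lambda>\<rho>. evn (\<rho> 0))"
    by (rule definable_iff_iff) (unfold adder_def, intro def_intros)
qed

lemma evn_zero [simp]: "evn zero"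
  unfolding evn_def by (rule exI[of _ zero]) simp

lemma evn_double [simp]: "k \<^bold>\<in> omega \<Longrightarrow> evn (add k k)"
  unfolding evn_def by blast

lemma not_evn_one: "\<not> evn (succ zero)"
proof
  assume "evn (succ zero)"
  then obtain k where k: "k \<^bold>\<in> omega" "succ zero = add k k" by (auto simp: evn_def)
  then show False by (cases rule: omega_cases[OF k(1)]) auto
qed

lemma evn_succ_succ:
  assumes "m \<^bold>\<in> omega"
  shows "evn (succ (succ m)) \<longleftrightarrow> evn m"
proof
  assume "evn (succ (succ m))"
  then obtain k where k: "k \<^bold>\<in> omega" "succ (succ m) = add k k" by (auto simp: evn_def)
  then show "evn m" by (cases rule: omega_cases[OF k(1)]) auto
next
  assume "evn m"
  then obtain k where k: "k \<^bold>\<in> omega" "m = add k k" by (auto simp: evn_def)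
  then have "succ (succ m) = add (succ k) (succ k)" by simp
  with k(1) show "evn (succ (succ m))" unfolding evn_def using succ_omega by blast
qed

lemma evn_succ [simp]:
  assumes "m \<^bold>\<in> omega"
  shows "evn (succ m) \<longleftrightarrow> \<not> evn m"
  using assms
proof (induction rule: omega_induct)
  case definable
  show ?case by (intro def_intros)
qed (auto simp: not_evn_one evn_succ_succ)

lemma odd_double:
  assumes "m \<^bold>\<in> omega" "\<not> evn m"
  obtains k where "k \<^bold>\<in> omega" "m = succ (add k k)"
proof -
  have "evn (succ m)" using assms by simp
  then obtain j where j: "j \<^bold>\<in> omega" "succ m = add j j" by (auto simp: evn_def)
  then show ?thesis using that by (cases rule: omega_cases[OF j(1)]) auto
qed

section \<open>The game\<close>

text \<open>This acts on finite positions as well as on infinite runs. Cutting down to pairs of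
  naturals makes it a set for every argument, so its members can be described without typing
  assumptions.\<close>

definition shift :: "'v \<Rightarrow> 'v" where
  "shift s = compr (\<lambda>p. p \<^bold>\<in> prod_set omega omega \<and> (\<exists>i v. p = opair i v \<and> opair (succ i) v \<^bold>\<in> s))"

definition cons :: "'v \<Rightarrow> 'v \<Rightarrow> 'v" where
  "cons m s = compr (\<lambda>p. p \<^bold>\<in> prod_set omega omega \<and>
     (p = opair zero m \<or> (\<exists>i v. p = opair (succ i) v \<and> opair i v \<^bold>\<in> s)))"

lemma definable_shift [def_intros]: "definable_term t \<Longrightarrow> definable_term (\<lambda>\<rho>. shift (t \<rho>))"
  by (rule definable_term_subst[where F = shift]) (unfold shift_def, intro def_intros)

lemma definable_cons [def_intros]:
  "definable_term t \<Longrightarrow> definable_term u \<Longrightarrow> definable_term (\<lambda>\<rho>. cons (t \<rho>) (u \<rho>))"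
  by (rule definable_term_subst2[where F = cons]) (unfold cons_def, intro def_intros)

lemma mem_shift:
  "p \<^bold>\<in> shift s \<longleftrightarrow> p \<^bold>\<in> prod_set omega omega \<and> (\<exists>i v. p = opair i v \<and> opair (succ i) v \<^bold>\<in> s)"
  unfolding shift_def by (rule mem_compr[where B = "prod_set omega omega"], intro def_intros) blast

lemma mem_cons:
  "p \<^bold>\<in> cons m s \<longleftrightarrow> p \<^bold>\<in> prod_set omega omega \<and>
     (p = opair zero m \<or> (\<exists>i v. p = opair (succ i) v \<and> opair i v \<^bold>\<in> s))"
  unfolding cons_def by (rule mem_compr[where B = "prod_set omega omega"], intro def_intros) blast

lemma shift_funs:
  assumes "y \<^bold>\<in> funs omega omega"
  shows "shift y \<^bold>\<in> funs omega omega" "\<And>i. i \<^bold>\<in> omega \<Longrightarrow> ap (shift y) i = ap y (succ i)"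
proof -
  have "p \<^bold>\<in> shift y \<longleftrightarrow> (\<exists>x. x \<^bold>\<in> omega \<and> p = opair x (ap y (succ x)))" for p
    using ap_type[OF assms] by (auto simp: mem_shift mem_prod_set funs_opair[OF assms])
  from funs_graph[OF this, of omega] ap_type[OF assms]
  show "shift y \<^bold>\<in> funs omega omega" "\<And>i. i \<^bold>\<in> omega \<Longrightarrow> ap (shift y) i = ap y (succ i)"
    by auto
qed

lemma omega_succ_iff [simp]: "succ i \<^bold>\<in> omega \<longleftrightarrow> i \<^bold>\<in> omega"
  using omega_trans[of "succ i" i] by auto

lemma cons_funs:
  assumes y: "y \<^bold>\<in> funs omega omega" and m: "m \<^bold>\<in> omega"
  shows "cons m y \<^bold>\<in> funs omega omega" "ap (cons m y) zero = m"
    "\<And>i. i \<^bold>\<in> omega \<Longrightarrow> ap (cons m y) (succ i) = ap y i"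
proof -
  have *: "opair x v \<^bold>\<in> cons m y \<longleftrightarrow> x = zero \<and> v = m \<or> (\<exists>i. i \<^bold>\<in> omega \<and> x = succ i \<and> v = ap y i)" for x v
    using m ap_type[OF y] by (auto simp: mem_cons funs_opair[OF y])
  have "\<exists>!v. opair x v \<^bold>\<in> cons m y" if "x \<^bold>\<in> omega" for x
    by (cases rule: omega_cases[OF that]) (auto simp: *)
  then show "cons m y \<^bold>\<in> funs omega omega"
    by (auto simp: mem_funs subset_def mem_cons)
  show "ap (cons m y) zero = m" "\<And>i. i \<^bold>\<in> omega \<Longrightarrow> ap (cons m y) (succ i) = ap y i"
    by (rule ap_eqI; simp add: *)+
qed

lemma shift_cons:
  assumes "y \<^bold>\<in> funs omega omega" "m \<^bold>\<in> omega"
  shows "shift (cons m y) = y"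
  using shift_funs[OF cons_funs(1)[OF assms]] cons_funs(3)[OF assms]
  by (intro funs_ext[OF _ assms(1)]) auto

lemma restr_shift:
  assumes "k \<^bold>\<in> omega"
  shows "restr (shift y) k = shift (restr y (succ k))"
  using assms
  by (intro extensionality)
     (auto simp: mem_restr mem_shift succ_mem_succ simp del: mem_succ)

lemma restr_cons:
  assumes "k \<^bold>\<in> omega"
  shows "restr (cons m y) (succ k) = cons m (restr y k)"
  using assms zero_mem_succ[OF assms]
  by (intro extensionality)
     (auto simp: mem_restr mem_cons succ_mem_succ simp del: mem_succ)

text \<open>\<open>T\<close> is a HOL function on positions, so that both a strategy of II and the
  map sending \<open>s\<close> to the answer of I's strategy at \<open>cons m s\<close> are
  instances.\<close>

definition follows :: "('v \<Rightarrow> 'v) \<Rightarrow> 'v \<Rightarrow> bool" where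
  "follows T z \<longleftrightarrow> (\<forall>k. k \<^bold>\<in> omega \<longrightarrow> ap z (succ (add k k)) = T (restr z (succ (add k k))))"

text \<open>
  Strategy stealing: \<open>T\<close> answers at every position of the run, at odd ones as in the run itself
  and at even ones as in its shift.
\<close>

lemma ex_doubly_following:
  assumes T: "definable_term (\<lambda>\<rho>. T (\<rho> 0))" "\<And>z k. z \<^bold>\<in> funs omega omega \<Longrightarrow> k \<^bold>\<in> omega \<Longrightarrow> T (restr z k) \<^bold>\<in> omega"
    and c: "c \<^bold>\<in> omega"
  obtains z where "z \<^bold>\<in> funs omega omega" "ap z zero = c" "follows T z" "follows T (shift z)"
proof -
  \<comment> \<open>\<open>dom s\<close> is the index of the move to be made; an even index 2k+2 of
    the run is the odd index 2k+1 of its shift. The defaults \<open>c\<close> give \<open>z\<close>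
    its type first, and only then does the hypothesis on \<open>T\<close> show that they never occur
    on the run.\<close>
  define G where "G s = (if s = zero then c
    else if evn (dom s) then if T (shift s) \<^bold>\<in> omega then T (shift s) else c
    else if T s \<^bold>\<in> omega then T s else c)" for s
  obtain z where z: "z \<^bold>\<in> funs omega omega" "\<And>k. k \<^bold>\<in> omega \<Longrightarrow> ap z k = G (restr z k)"
  proof (rule recursion)
    show "definable_term (\<lambda>\<rho>. G (\<rho> 0))"
      unfolding G_def by (intro def_intros definable_term_subst[OF T(1)])
    show "G s \<^bold>\<in> omega" for s using c by (simp add: G_def)
  qed blast
  note sz = shift_funs[OF z(1)]
  have "ap z zero = c" using z(2)[of zero] by (simp add: G_def)
  moreover have "follows T z"
    unfolding follows_def
  proof (intro allI impI)
    fix k assume k: "k \<^bold>\<in> omega"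
    let ?n = "succ (add k k)"
    have "T (restr z ?n) \<^bold>\<in> omega"
      using T(2)[OF z(1)] k by simp
    then show "ap z ?n = T (restr z ?n)"
      using z(2)[of ?n] k restr_succ_neq_zero[OF z(1)] restr_finseqs(2)[OF z(1), of ?n]
      by (simp add: G_def)
  qed
  moreover have "follows T (shift z)"
    unfolding follows_def
  proof (intro allI impI)
    fix k assume k: "k \<^bold>\<in> omega"
    let ?n = "succ (add k k)"
    have "T (restr (shift z) ?n) \<^bold>\<in> omega"
      using T(2)[OF sz(1)] k by simp
    then show "ap (shift z) ?n = T (restr (shift z) ?n)"
      using z(2)[of "succ ?n"] k restr_succ_neq_zero[OF z(1)] restr_finseqs(2)[OF z(1), of "succ ?n"]
      by (simp add: G_def sz(2) restr_shift)
  qed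
  ultimately show ?thesis using z(1) that by blast
qed

section \<open>Increasing sequences and their blocks\<close>

definition inc :: "'v \<Rightarrow> bool" where
  "inc y \<longleftrightarrow> (\<forall>i. i \<^bold>\<in> omega \<longrightarrow> ap y i \<^bold>\<in> ap y (succ i))"

text \<open>Membership in \<open>succ j\<close> means being at most \<open>j\<close>, so the two
  membership conditions place \<open>j\<close> in the half-open interval from \<open>ap y i\<close>
  to \<open>ap y (succ i)\<close>.\<close>

definition blocks :: "'v \<Rightarrow> 'v" where
  "blocks y = lam omega (\<lambda>j.
     if \<exists>i. i \<^bold>\<in> omega \<and> evn i \<and> ap y i \<^bold>\<in> succ j \<and> j \<^bold>\<in> ap y (succ i) then one else zero)"

lemma inc_mono:
  assumes "y \<^bold>\<in> funs omega omega" "inc y" "k \<^bold>\<in> omega" "i \<^bold>\<in> k"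
  shows "ap y i \<^bold>\<in> ap y k"
  using assms(3,4)
proof (induction rule: omega_induct)
  case definable
  show ?case by (intro def_intros)
next
  case (succ k)
  have "ap y k \<^bold>\<in> ap y (succ k)" "ap y (succ k) \<^bold>\<in> omega"
    using assms(2) succ(1) ap_type[OF assms(1)] by (auto simp: inc_def)
  then show ?case
    using succ mem_trans[of "ap y (succ k)" "ap y k" "ap y i"] by auto
qed simp

lemma inc_ge:
  assumes "y \<^bold>\<in> funs omega omega" "inc y" "k \<^bold>\<in> omega"
  shows "k \<^bold>\<in> succ (ap y k)"
  using assms(3)
proof (induction rule: omega_induct)
  case definable
  show ?case by (intro def_intros)
next
  case zero
  show ?case using ap_type[OF assms(1)] by (intro zero_mem_succ) simp
next
  case (succ k)
  have *: "ap y k \<^bold>\<in> ap y (succ k)" "ap y (succ k) \<^bold>\<in> omega"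
    using assms(2) succ(1) ap_type[OF assms(1)] by (auto simp: inc_def)
  have "k \<^bold>\<in> ap y (succ k)"
    using succ(2) * mem_trans[OF *(2,1), of k] by auto
  then show ?case
    using succ_mem_succ[OF *(2)] by blast
qed

text \<open>Start from an endpoint above \<open>j\<close>, namely the one with index
  \<open>succ j\<close> by \<open>inc_ge\<close>, and go down until the preceding endpoint is at
  most \<open>j\<close>. The induction on \<open>k\<close> performs this descent.\<close>

lemma inc_block_ex:
  assumes y: "y \<^bold>\<in> funs omega omega" "inc y" and j: "j \<^bold>\<in> omega" "\<not> j \<^bold>\<in> ap y zero"
  shows "\<exists>i. i \<^bold>\<in> omega \<and> ap y i \<^bold>\<in> succ j \<and> j \<^bold>\<in> ap y (succ i)"
proof -
  have *: "j \<^bold>\<in> ap y k \<longrightarrow> (\<exists>i. i \<^bold>\<in> omega \<and> ap y i \<^bold>\<in> succ j \<and> j \<^bold>\<in> ap y (succ i))"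
    if "k \<^bold>\<in> omega" for k
    using that
  proof (induction rule: omega_induct)
    case definable
    show ?case by (intro def_intros)
  next
    case zero
    then show ?case using j by simp
  next
    case (succ k)
    then show ?case
      using omega_linear[OF j(1), of "ap y k"] ap_type[OF y(1)] by auto
  qed
  have "j \<^bold>\<in> succ (ap y j)" "ap y j \<^bold>\<in> ap y (succ j)" "ap y (succ j) \<^bold>\<in> omega"
    using inc_ge[OF y j(1)] y(2) j(1) ap_type[OF y(1)] by (auto simp: inc_def)
  then have "j \<^bold>\<in> ap y (succ j)"
    using mem_trans[of "ap y (succ j)" "ap y j" j] by auto
  then show ?thesis using *[of "succ j"] j(1) by simp
qed

text \<open>For a < b, block a ends at \<open>ap y (succ a)\<close>, which is at most the start
  \<open>ap y b\<close> of block b.\<close>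

lemma inc_block_unique:
  assumes y: "y \<^bold>\<in> funs omega omega" "inc y" and j: "j \<^bold>\<in> omega"
    and i: "i \<^bold>\<in> omega" "ap y i \<^bold>\<in> succ j" "j \<^bold>\<in> ap y (succ i)"
    and i': "i' \<^bold>\<in> omega" "ap y i' \<^bold>\<in> succ j" "j \<^bold>\<in> ap y (succ i')"
  shows "i = i'"
proof -
  have *: False if "a \<^bold>\<in> b" "b \<^bold>\<in> omega" "ap y b \<^bold>\<in> succ j" "j \<^bold>\<in> ap y (succ a)" for a b
  proof -
    have "succ a \<^bold>\<in> succ b" using that succ_mem_succ by blast
    then have "ap y (succ a) \<^bold>\<in> succ (ap y b)"
      using inc_mono[OF y that(2)] by auto
    then have "j \<^bold>\<in> ap y b"
      using that mem_trans[of "ap y b" "ap y (succ a)" j] ap_type[OF y(1)] by auto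
    then show False
      using that(3) not_mem_cycle[of j "ap y b"] by auto
  qed
  show ?thesis
    using omega_linear[OF i(1) i'(1)] * i i' by blast
qed

lemma mem_two [simp]: "w \<^bold>\<in> two \<longleftrightarrow> w = zero \<or> w = one"
  by (auto simp: two_def one_def)

lemma one_neq_zero [simp]: "one \<noteq> zero" "zero \<noteq> one"
  by (simp_all add: one_def)

lemma definable_blocks [def_intros]: "definable_term t \<Longrightarrow> definable_term (\<lambda>\<rho>. blocks (t \<rho>))"
  by (rule definable_term_subst[where F = blocks]) (unfold blocks_def lam_def, intro def_intros)

lemma blocks:
  shows "blocks y \<^bold>\<in> cantor"
    and "j \<^bold>\<in> omega \<Longrightarrow> ap (blocks y) j =
      (if \<exists>i. i \<^bold>\<in> omega \<and> evn i \<and> ap y i \<^bold>\<in> succ j \<and> j \<^bold>\<in> ap y (succ i) then one else zero)"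
  unfolding blocks_def cantor_def
  by (rule lam[where B = two]; (intro def_intros)?; simp)+

text \<open>Deleting the first endpoint lowers every block index by one and so reverses its parity.
  From that endpoint on each \<open>j\<close> lies in exactly one block, so the sequences differ
  there; below it the sequence of \<open>y\<close> and that of its shift are both zero.\<close>

lemma blocks_shift:
  assumes y: "y \<^bold>\<in> funs omega omega" "inc y" and j: "j \<^bold>\<in> omega"
  shows "ap (blocks y) j = ap (blocks (shift y)) j \<longleftrightarrow> j \<^bold>\<in> ap y zero"
proof -
  let ?in = "\<lambda>i. i \<^bold>\<in> omega \<and> ap y i \<^bold>\<in> succ j \<and> j \<^bold>\<in> ap y (succ i)"
  have 1: "ap (blocks y) j = one \<longleftrightarrow> (\<exists>i. ?in i \<and> evn i)"
    using blocks(2)[OF j, of y] by auto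
  have "ap (blocks (shift y)) j = one \<longleftrightarrow> (\<exists>i. ?in (succ i) \<and> evn i)"
    using blocks(2)[OF j, of "shift y"] by (auto simp: shift_funs(2)[OF y(1)])
  also have "\<dots> \<longleftrightarrow> (\<exists>i. ?in i \<and> \<not> evn i)"
  proof
    \<comment> \<open>Since zero is even, an odd index is a successor.\<close>
    assume "\<exists>i. ?in i \<and> \<not> evn i"
    then obtain i where i: "?in i" "\<not> evn i" by blast
    from i(1) have "i \<^bold>\<in> omega" by blast
    then show "\<exists>i. ?in (succ i) \<and> evn i"
    proof (cases rule: omega_cases)
      case (2 m)
      with i show ?thesis by (intro exI[of _ m]) auto
    qed (use i in simp)
  qed (metis evn_succ omega_succ_iff)
  finally have 2: "ap (blocks (shift y)) j = one \<longleftrightarrow> (\<exists>i. ?in i \<and> \<not> evn i)" .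
  have 3: "ap (blocks v) j = one \<or> ap (blocks v) j = zero" for v
    using blocks(2)[OF j, of v] by auto
  show ?thesis
  proof (cases "j \<^bold>\<in> ap y zero")
    case True
    have "\<not> ?in i" for i
    proof
      assume i: "?in i"
      then have "ap y zero \<^bold>\<in> succ (ap y i)"
        using inc_mono[OF y, of i zero] zero_mem_succ[of i] by auto
      with i True have "j \<^bold>\<in> ap y i"
        using mem_trans[of "ap y i" "ap y zero" j] ap_type[OF y(1), of i] by auto
      with i show False using not_mem_cycle[of j "ap y i"] by auto
    qed
    with True 1 2 3[of y] 3[of "shift y"] show ?thesis by auto
  next
    case False
    then obtain i where "?in i" using inc_block_ex[OF y j] by blast
    with inc_block_unique[OF y j] have "?in i' \<Longrightarrow> i' = i" for i' by blast
    with \<open>?in i\<close> False 1 2 3[of y] 3[of "shift y"] show ?thesis by (metis one_neq_zero(1))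
  qed
qed

text \<open>The core shared by both players. \<open>legal\<close> says that \<open>T\<close> is
  never the first to break the increase. The opponent's opening must exceed \<open>m\<close>, which
  is zero against a strategy of II and the fixed first move against one of I.\<close>

lemma no_winning_strategy:
  assumes T: "definable_term (\<lambda>\<rho>. T (\<rho> 0))" "\<And>z k. z \<^bold>\<in> funs omega omega \<Longrightarrow> k \<^bold>\<in> omega \<Longrightarrow> T (restr z k) \<^bold>\<in> omega"
    and m: "m \<^bold>\<in> omega"
    and A: "\<And>y. y \<^bold>\<in> funs omega omega \<Longrightarrow> inc y \<Longrightarrow> A (blocks y) \<longleftrightarrow> \<not> A (blocks (shift y))"
    and legal: "\<And>z n. z \<^bold>\<in> funs omega omega \<Longrightarrow> follows T z \<Longrightarrow> m \<^bold>\<in> ap z zero \<Longrightarrow> n \<^bold>\<in> omega \<Longrightarrow>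
      (\<And>j. j \<^bold>\<in> add n n \<Longrightarrow> ap z j \<^bold>\<in> ap z (succ j)) \<Longrightarrow> ap z (add n n) \<^bold>\<in> ap z (succ (add n n))"
    and win: "\<And>z. z \<^bold>\<in> funs omega omega \<Longrightarrow> follows T z \<Longrightarrow> m \<^bold>\<in> ap z zero \<Longrightarrow> inc z \<Longrightarrow> \<not> A (blocks z)"
  shows False
proof -
  \<comment> \<open>The opening \<open>succ m\<close> exceeds \<open>m\<close>, and so does the
    legal answer to it, which is the opening move of the shift. Thus both runs meet the side
    condition.\<close>
  obtain z where z: "z \<^bold>\<in> funs omega omega" "ap z zero = succ m" "follows T z" "follows T (shift z)"
    using ex_doubly_following[OF T succ_omega[OF m]] by blast
  note sz = shift_funs[OF z(1)]
  have m0: "m \<^bold>\<in> ap z zero" using z(2) by simp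
  have "ap z zero \<^bold>\<in> ap z (succ zero)"
    using legal[OF z(1,3) m0 zero_omega] by simp
  then have m1: "m \<^bold>\<in> ap (shift z) zero"
    using m0 mem_trans[OF ap_type[OF z(1)] _ m0] sz by simp
  have step: "ap z k \<^bold>\<in> ap z (succ k)"
    if k: "k \<^bold>\<in> omega" and below: "\<And>i. i \<^bold>\<in> k \<Longrightarrow> ap z i \<^bold>\<in> ap z (succ i)" for k
  \<comment> \<open>The move at \<open>succ k\<close> is an answer of \<open>T\<close> in the run if
    \<open>k\<close> is even and in the shift if \<open>k\<close> is odd; \<open>legal\<close> is
    applied to that one.\<close>
  proof (cases "evn k")
    case True
    then obtain n where n: "n \<^bold>\<in> omega" "k = add n n" by (auto simp: evn_def)
    show ?thesis using legal[OF z(1,3) m0 n(1)] below by (simp add: n)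
  next
    case False
    then obtain n where n: "n \<^bold>\<in> omega" "k = succ (add n n)"
      using odd_double k by blast
    have "ap (shift z) (add n n) \<^bold>\<in> ap (shift z) (succ (add n n))"
    proof (rule legal[OF sz(1) z(4) m1 n(1)])
      fix j assume j: "j \<^bold>\<in> add n n"
      then have "j \<^bold>\<in> omega" using omega_trans[OF add_omega[OF n(1) n(1)]] by simp
      moreover have "succ j \<^bold>\<in> k"
        using j n by (simp only: succ_mem_succ add_omega)
      ultimately show "ap (shift z) j \<^bold>\<in> ap (shift z) (succ j)"
        using below by (simp add: sz(2))
    qed
    with n show ?thesis by (simp add: sz(2))
  qed
  \<comment> \<open>This is strong induction, put as a definable statement about the numbers below
    \<open>k\<close>.\<close>
  have "\<forall>i. i \<^bold>\<in> k \<longrightarrow> ap z i \<^bold>\<in> ap z (succ i)" if "k \<^bold>\<in> omega" for k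
    using that
  proof (induction rule: omega_induct)
    case definable
    show ?case by (intro def_intros)
  qed (use step in auto)
  with step have inc: "inc z"
    unfolding inc_def by blast
  then have "inc (shift z)"
    by (simp add: inc_def sz(2))
  then have "\<not> A (blocks z)" "\<not> A (blocks (shift z))"
    using win z(1,3,4) sz(1) m0 m1 inc by blast+
  with A[OF z(1) inc] show False by blast
qed

lemma mem_finseqs: "s \<^bold>\<in> finseqs B \<longleftrightarrow> (\<exists>n. n \<^bold>\<in> omega \<and> s \<^bold>\<in> funs n B)"
proof -
  obtain q where q: "\<forall>y. y \<^bold>\<in> q \<longleftrightarrow> (\<forall>w. w \<^bold>\<in> y \<longrightarrow> w \<^bold>\<in> prod_set omega B)"
    using powerset by blast
  have bound: "s \<^bold>\<in> q" if "n \<^bold>\<in> omega" "s \<^bold>\<in> funs n B" for n s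
    using omega_trans[OF that(1)] ap_type[OF that(2)] by (auto simp: q funs_mem[OF that(2)])
  show ?thesis
    unfolding finseqs_def by (rule mem_compr[where B = q], intro def_intros) (use bound in blast)
qed

theorem not_AD:
  assumes defA: "definable (\<lambda>\<rho>. A (\<rho> 0))"
    and A: "\<And>y. y \<^bold>\<in> funs omega omega \<Longrightarrow> inc y \<Longrightarrow> A (blocks y) \<longleftrightarrow> \<not> A (blocks (shift y))"
  shows "\<not> AD"
proof
  assume AD
  \<comment> \<open>For even \<open>i\<close> the move at \<open>succ i\<close> belongs to II, so
    this says that II is the first to break the increase.\<close>
  define bad where "bad y \<longleftrightarrow> (\<exists>i. i \<^bold>\<in> omega \<and> evn i \<and> \<not> ap y i \<^bold>\<in> ap y (succ i) \<and>
    (\<forall>j. j \<^bold>\<in> i \<longrightarrow> ap y j \<^bold>\<in> ap y (succ j)))" for y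
  define B where "B = compr (\<lambda>y. y \<^bold>\<in> funs omega omega \<and> (inc y \<and> A (blocks y) \<or> bad y))"
  \<comment> \<open>AD covers only payoff sets that exist in the model; definability of
    \<open>A\<close> is what makes \<open>B\<close> one.\<close>
  have B: "y \<^bold>\<in> B \<longleftrightarrow> y \<^bold>\<in> funs omega omega \<and> (inc y \<and> A (blocks y) \<or> bad y)" for y
    unfolding B_def bad_def inc_def
    by (rule mem_compr[where B = "funs omega omega"],
        intro def_intros definable_subst1[OF defA]) blast
  then have "determined B"
    using \<open>AD\<close> by (simp add: AD_def subset_def)
  then consider
    (I) \<sigma> where "\<sigma> \<^bold>\<in> funs (finseqs omega) omega"
      "\<And>x. x \<^bold>\<in> funs omega omega \<Longrightarrow> follows_I \<sigma> x \<Longrightarrow> x \<^bold>\<in> B"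
  | (II) \<tau> where "\<tau> \<^bold>\<in> funs (finseqs omega) omega"
      "\<And>x. x \<^bold>\<in> funs omega omega \<Longrightarrow> follows_II \<tau> x \<Longrightarrow> \<not> x \<^bold>\<in> B"
    unfolding determined_def by blast
  then show False
  proof cases
    case (II \<tau>)
    have notB: "\<not> z \<^bold>\<in> B" if z: "z \<^bold>\<in> funs omega omega" "follows (ap \<tau>) z" for z
    proof (rule II(2)[OF z(1)])
      have "app \<tau> (restr z n) = ap \<tau> (restr z n)" "app z n = ap z n" if "n \<^bold>\<in> omega" for n
        using app_eq_ap[OF II(1)] app_eq_ap[OF z(1)] restr_finseqs(1)[OF z(1) that] that
        by (auto simp: mem_finseqs)
      then show "follows_II \<tau> z"
        using z(2) by (simp add: follows_II_def follows_def)
    qed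
    show False
    proof (rule no_winning_strategy[of "ap \<tau>" zero A])
      show "definable_term (\<lambda>\<rho>. ap \<tau> (\<rho> 0))" by (intro def_intros)
      show "ap \<tau> (restr z k) \<^bold>\<in> omega" if "z \<^bold>\<in> funs omega omega" "k \<^bold>\<in> omega" for z k
        using restr_finseqs(1)[OF that] that(2) by (intro ap_type[OF II(1)]) (auto simp: mem_finseqs)
    next
      fix z n assume z: "z \<^bold>\<in> funs omega omega" "follows (ap \<tau>) z" "n \<^bold>\<in> omega"
        and "\<And>j. j \<^bold>\<in> add n n \<Longrightarrow> ap z j \<^bold>\<in> ap z (succ j)"
      moreover have "\<not> bad z" using notB[OF z(1,2)] z(1) by (simp add: B)
      ultimately show "ap z (add n n) \<^bold>\<in> ap z (succ (add n n))"
        unfolding bad_def by (metis add_omega evn_double)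
    next
      fix z assume "z \<^bold>\<in> funs omega omega" "follows (ap \<tau>) z" "inc z"
      with notB[of z] show "\<not> A (blocks z)" by (simp add: B)
    qed (use A in simp_all)
  next
    case (I \<sigma>)
    \<comment> \<open>\<open>zero\<close> is also the empty sequence, so this is the opening move
      that the strategy of I prescribes.\<close>
    define m where "m = ap \<sigma> zero"
    have fin: "s \<^bold>\<in> finseqs omega" if "s \<^bold>\<in> funs k omega" "k \<^bold>\<in> omega" for s k
      using that by (auto simp: mem_finseqs)
    have "zero \<^bold>\<in> funs zero omega" by (simp add: mem_funs subset_def)
    then have m: "m \<^bold>\<in> omega"
      unfolding m_def using ap_type[OF I(1) fin] zero_omega by blast
    \<comment> \<open>Prefixing \<open>m\<close> carries index 2k+1 of \<open>z\<close> to index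
      2k+2, where I moves. The opening move at index 0 agrees with the strategy by the choice of
      \<open>m\<close>.\<close>
    have inB: "cons m z \<^bold>\<in> B" if z: "z \<^bold>\<in> funs omega omega" "follows (\<lambda>s. ap \<sigma> (cons m s)) z" for z
    proof (rule I(2)[OF cons_funs(1)[OF z(1) m]])
      note c = cons_funs[OF z(1) m]
      have eq: "app \<sigma> (restr (cons m z) n) = ap \<sigma> (restr (cons m z) n)"
          "app (cons m z) n = ap (cons m z) n" if "n \<^bold>\<in> omega" for n
        using app_eq_ap[OF I(1)] app_eq_ap[OF c(1)] fin restr_finseqs(1)[OF c(1) that] that
        by auto
      have "ap (cons m z) (add n n) = ap \<sigma> (restr (cons m z) (add n n))" if "n \<^bold>\<in> omega" for n
        using that
      proof (cases rule: omega_cases)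
        case 1
        then show ?thesis by (simp add: c(2) flip: m_def)
      next
        case (2 k)
        have "ap (cons m z) (succ (succ (add k k))) = ap \<sigma> (cons m (restr z (succ (add k k))))"
          using z(2) 2 c(3) by (simp add: follows_def)
        then show ?thesis using 2 by (simp add: restr_cons)
      qed
      then show "follows_I \<sigma> (cons m z)"
        by (simp add: follows_I_def eq)
    qed
    show False
    proof (rule no_winning_strategy[of "\<lambda>s. ap \<sigma> (cons m s)" m A])
      show "definable_term (\<lambda>\<rho>. ap \<sigma> (cons m (\<rho> 0)))" by (intro def_intros)
      show "ap \<sigma> (cons m (restr z k)) \<^bold>\<in> omega" if "z \<^bold>\<in> funs omega omega" "k \<^bold>\<in> omega" for z k
        using restr_finseqs(1)[OF cons_funs(1)[OF that(1) m] succ_omega[OF that(2)]] that(2)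
        by (intro ap_type[OF I(1)] fin[of _ "succ k"]) (simp_all add: restr_cons)
    next
      fix z n assume z: "z \<^bold>\<in> funs omega omega" "follows (\<lambda>s. ap \<sigma> (cons m s)) z"
        "m \<^bold>\<in> ap z zero" and n: "n \<^bold>\<in> omega"
        and below: "\<And>j. j \<^bold>\<in> add n n \<Longrightarrow> ap z j \<^bold>\<in> ap z (succ j)"
      note c = cons_funs[OF z(1) m]
      let ?y = "cons m z" and ?k = "succ (add n n)"
      have k: "?k \<^bold>\<in> omega" "\<not> evn ?k" using n by simp_all
      have y: "ap ?y i \<^bold>\<in> ap ?y (succ i)" if "i \<^bold>\<in> ?k" for i
      proof (cases rule: omega_cases[OF omega_trans[OF k(1) that]])
        case 1
        then show ?thesis using z(3) c(2) c(3)[of zero] by simp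
      next
        case (2 j)
        then show ?thesis using below[of j] that n c(3) succ_mem_succ[of "add n n" j] by (simp del: mem_succ)
      qed
      show "ap z (add n n) \<^bold>\<in> ap z (succ (add n n))"
      proof (rule ccontr)
        assume "\<not> ?thesis"
        \<comment> \<open>The first failure of \<open>?y\<close> would be at the odd index
          \<open>?k\<close>, hence due to I. But \<open>?y\<close> is in \<open>B\<close> without
          being increasing, so its first failure must be at an even index.\<close>
        then have viol: "\<not> ap ?y ?k \<^bold>\<in> ap ?y (succ ?k)"
          using c(3) n by simp
        then have "bad ?y"
          using inB[OF z(1,2)] k(1) by (auto simp: B inc_def)
        then obtain i where i: "i \<^bold>\<in> omega" "evn i" "\<not> ap ?y i \<^bold>\<in> ap ?y (succ i)"
          "\<And>j. j \<^bold>\<in> i \<Longrightarrow> ap ?y j \<^bold>\<in> ap ?y (succ j)"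
          unfolding bad_def by blast
        from omega_linear[OF i(1) k(1)] show False
          using i y viol k(2) by blast
      qed
    next
      fix z assume z: "z \<^bold>\<in> funs omega omega" "follows (\<lambda>s. ap \<sigma> (cons m s)) z"
        "m \<^bold>\<in> ap z zero" "inc z"
      note c = cons_funs[OF z(1) m]
      have "ap (cons m z) i \<^bold>\<in> ap (cons m z) (succ i)" if "i \<^bold>\<in> omega" for i
        using that
      proof (cases rule: omega_cases)
        case 1
        then show ?thesis using z(3) c(2) c(3)[of zero] by simp
      next
        case (2 j)
        then show ?thesis using z(4) c(3) by (simp add: inc_def)
      qed
      then have inc: "inc (cons m z)" by (simp add: inc_def)
      \<comment> \<open>An increasing run is in \<open>B\<close> only through \<open>A\<close>.
        Dropping \<open>m\<close>, the first endpoint, then exchanges winning and losing and yields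
        the claim for \<open>z\<close>.\<close>
      then have "A (blocks (cons m z))"
        using inB[OF z(1,2)] by (auto simp: B bad_def inc_def)
      then show "\<not> A (blocks z)"
        using A[OF c(1) inc] by (simp add: shift_cons[OF z(1) m])
    qed (use A m in simp_all)
  qed
qed

section \<open>The quotient\<close>

text \<open>\<open>flip\<close> is built on \<open>app\<close>. This variant uses \<open>ap\<close>,
  so it is a definable term and lands in \<open>cantor\<close> for every argument; on
  \<open>cantor\<close> the two agree.\<close>

definition flipc :: "'v \<Rightarrow> 'v" where
  "flipc x = lam omega (\<lambda>j. if ap x j = zero then one else zero)"

lemma definable_flipc [def_intros]: "definable_term t \<Longrightarrow> definable_term (\<lambda>\<rho>. flipc (t \<rho>))"
  by (rule definable_term_subst[where F = flipc]) (unfold flipc_def lam_def, intro def_intros)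

lemma flipc:
  shows "flipc x \<^bold>\<in> cantor"
    and "j \<^bold>\<in> omega \<Longrightarrow> ap (flipc x) j = (if ap x j = zero then one else zero)"
  unfolding flipc_def cantor_def
  by (rule lam[where B = two]; (intro def_intros)?; simp)+

lemma flip_eq_flipc:
  assumes "x \<^bold>\<in> cantor"
  shows "flip x = flipc x"
  unfolding flip_def flipc_def lam_def
  using assms by (intro compr_cong) (auto simp: cantor_def funs_dom app_eq_ap)

lemma cantor_ext: "x \<^bold>\<in> cantor \<Longrightarrow> y \<^bold>\<in> cantor \<Longrightarrow> (\<And>j. j \<^bold>\<in> omega \<Longrightarrow> ap x j = ap y j) \<Longrightarrow> x = y"
  unfolding cantor_def by (rule funs_ext)

lemma cantor_values: "x \<^bold>\<in> cantor \<Longrightarrow> j \<^bold>\<in> omega \<Longrightarrow> ap x j = zero \<or> ap x j = one"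
  unfolding cantor_def using ap_type[of x omega two j] by simp

lemma flipc_flipc:
  assumes "x \<^bold>\<in> cantor"
  shows "flipc (flipc x) = x"
proof (rule cantor_ext[OF flipc(1) assms])
  fix j assume "j \<^bold>\<in> omega"
  then show "ap (flipc (flipc x)) j = ap x j"
    using cantor_values[OF assms, of j] by (auto simp: flipc(2))
qed

lemma finite_set_iff:
  "finite_set A \<longleftrightarrow> (\<exists>n f. n \<^bold>\<in> omega \<and> f \<^bold>\<in> funs n A \<and>
     (\<forall>i j. i \<^bold>\<in> n \<longrightarrow> j \<^bold>\<in> n \<longrightarrow> ap f i = ap f j \<longrightarrow> i = j) \<and>
     (\<forall>a. a \<^bold>\<in> A \<longrightarrow> (\<exists>i. i \<^bold>\<in> n \<and> ap f i = a)))"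
  by (simp add: finite_set_def app_eq_ap cong: conj_cong)

lemma definable_finite_set [def_intros]:
  assumes "definable_term t"
  shows "definable (\<lambda>\<rho>. finite_set (t \<rho>))"
proof (rule definable_subst1[OF _ assms])
  show "definable (\<lambda>\<rho>. finite_set (\<rho> 0))"
    unfolding finite_set_iff by (intro def_intros)
qed

lemma finite_set_nat: "n \<^bold>\<in> omega \<Longrightarrow> finite_set n"
  unfolding finite_set_iff
proof (intro exI conjI)
  assume "n \<^bold>\<in> omega"
  note l = lam[of "\<lambda>x. x" n n, OF definable_term_var]
  show "lam n (\<lambda>x. x) \<^bold>\<in> funs n n" by (rule l)
  show "\<forall>i j. i \<^bold>\<in> n \<longrightarrow> j \<^bold>\<in> n \<longrightarrow> ap (lam n (\<lambda>x. x)) i = ap (lam n (\<lambda>x. x)) j \<longrightarrow> i = j"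
    "\<forall>a. a \<^bold>\<in> n \<longrightarrow> (\<exists>i. i \<^bold>\<in> n \<and> ap (lam n (\<lambda>x. x)) i = a)"
    by (auto simp: l)
qed

text \<open>The sequences compared below differ exactly at the numbers less than some
  \<open>n\<close>. The difference set is then the von Neumann number \<open>n\<close> itself,
  enumerated by the identity.\<close>

lemma E0_I:
  assumes "x \<^bold>\<in> cantor" "y \<^bold>\<in> cantor" "n \<^bold>\<in> omega"
    and "\<And>j. j \<^bold>\<in> omega \<Longrightarrow> ap x j \<noteq> ap y j \<longleftrightarrow> j \<^bold>\<in> n"
  shows "opair x y \<^bold>\<in> E0"
proof -
  let ?P = "\<lambda>p. \<exists>x y. x \<^bold>\<in> cantor \<and> y \<^bold>\<in> cantor \<and> p = opair x y \<and>
     finite_set (compr (\<lambda>n. n \<^bold>\<in> omega \<and> ap x n \<noteq> ap y n))"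
  have "(n \<^bold>\<in> omega \<and> app x n \<noteq> app y n) \<longleftrightarrow> (n \<^bold>\<in> omega \<and> ap x n \<noteq> ap y n)"
    if "x \<^bold>\<in> cantor" "y \<^bold>\<in> cantor" for x y n
    using that by (auto simp: cantor_def app_eq_ap)
  then have "E0 = compr ?P"
    unfolding E0_def by (intro compr_cong) (simp cong: conj_cong)
  moreover have "p \<^bold>\<in> compr ?P \<longleftrightarrow> ?P p" for p
    by (rule mem_compr[where B = "prod_set cantor cantor"]) (intro def_intros, auto)
  moreover have "compr (\<lambda>j. j \<^bold>\<in> omega \<and> ap x j \<noteq> ap y j) = n"
    using assms(4) omega_trans[OF assms(3)] by (intro compr_eqI) blast
  ultimately show ?thesis
    using assms(1,2) finite_set_nat[OF assms(3)] by auto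
qed

lemma concat_empty:
  assumes "x \<^bold>\<in> cantor"
  shows "concat zero x = x"
proof -
  have x: "x \<^bold>\<in> funs omega two" using assms by (simp add: cantor_def)
  have "dom zero = zero" by (simp add: eq_empty mem_dom)
  then show ?thesis
    unfolding concat_def using x
    by (intro compr_eqI) (auto simp: funs_dom funs_mem[OF x] app_eq_ap)
qed

section \<open>Equivalence classes and the quotient\<close>

definition cls :: "'v \<Rightarrow> 'v \<Rightarrow> 'v" where
  "cls R x = compr (\<lambda>y. opair x y \<^bold>\<in> R)"

lemma definable_cls [def_intros]:
  "definable_term t \<Longrightarrow> definable_term u \<Longrightarrow> definable_term (\<lambda>\<rho>. cls (t \<rho>) (u \<rho>))"
  by (rule definable_term_subst2[where F = cls]) (unfold cls_def, intro def_intros)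

lemma mem_cls:
  assumes "equivalence_on X R"
  shows "y \<^bold>\<in> cls R x \<longleftrightarrow> opair x y \<^bold>\<in> R"
  unfolding cls_def
proof (rule mem_compr[where B = X])
  show "definable (\<lambda>\<rho>. opair x (\<rho> 0) \<^bold>\<in> R)" by (intro def_intros)
  show "w \<^bold>\<in> X" if "opair x w \<^bold>\<in> R" for w
    using assms that unfolding equivalence_on_def subset_def by (metis opair_mem_prod_set)
qed

lemma cls_eq_iff:
  assumes "equivalence_on X R" "y \<^bold>\<in> X"
  shows "cls R x = cls R y \<longleftrightarrow> opair x y \<^bold>\<in> R"
proof
  assume "cls R x = cls R y"
  moreover have "y \<^bold>\<in> cls R y"
    using assms by (simp add: mem_cls[OF assms(1)] equivalence_on_def)
  ultimately show "opair x y \<^bold>\<in> R"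
    using mem_cls[OF assms(1)] by metis
next
  have R: "\<And>a b. opair a b \<^bold>\<in> R \<Longrightarrow> opair b a \<^bold>\<in> R"
    "\<And>a b c. opair a b \<^bold>\<in> R \<Longrightarrow> opair b c \<^bold>\<in> R \<Longrightarrow> opair a c \<^bold>\<in> R"
    using assms(1) unfolding equivalence_on_def by blast+
  assume "opair x y \<^bold>\<in> R"
  then show "cls R x = cls R y"
    using R by (intro extensionality) (metis mem_cls[OF assms(1)])
qed

lemma cls_quotient:
  assumes "equivalence_on X R" "x \<^bold>\<in> X"
  shows "cls R x \<^bold>\<in> quotient X R"
proof -
  obtain q where q: "\<forall>y. y \<^bold>\<in> q \<longleftrightarrow> (\<forall>w. w \<^bold>\<in> y \<longrightarrow> w \<^bold>\<in> X)"
    using powerset by blast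
  have sub: "w \<^bold>\<in> X" if "w \<^bold>\<in> cls R x" for w x
    using that assms(1) unfolding mem_cls[OF assms(1)] equivalence_on_def subset_def
    by (metis opair_mem_prod_set)
  have "cls R x \<^bold>\<in> quotient X R \<longleftrightarrow> (\<exists>x'. x' \<^bold>\<in> X \<and> cls R x = cls R x')"
    unfolding quotient_def cls_def[symmetric]
    by (rule mem_compr[where B = q], intro def_intros) (use q sub in auto)
  with assms(2) show ?thesis by blast
qed

theorem quotient_not_linear:
  assumes AD and eqv: "equivalence_on cantor E" and E0: "E0 \<^bold>\<subseteq> E"
    and noflip: "\<And>x. x \<^bold>\<in> cantor \<Longrightarrow> \<not> opair x (flipc x) \<^bold>\<in> E"
  shows "\<not> linear_order_on (quotient cantor E) L"
proof
  assume L: "linear_order_on (quotient cantor E) L"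
  define A where "A x \<longleftrightarrow> opair (cls E x) (cls E (flipc x)) \<^bold>\<in> L" for x
  have A_flipc: "A (flipc x) \<longleftrightarrow> \<not> A x" if x: "x \<^bold>\<in> cantor" for x
  proof -
    \<comment> \<open>Because the classes are distinct, antisymmetry forbids both directions of
      \<open>L\<close> between them, while totality provides one.\<close>
    have "cls E x \<noteq> cls E (flipc x)"
      using noflip[OF x] cls_eq_iff[OF eqv flipc(1)] by blast
    then show ?thesis
      using L cls_quotient[OF eqv x] cls_quotient[OF eqv flipc(1), of x]
      unfolding A_def flipc_flipc[OF x] linear_order_on_def by metis
  qed
  have A_inv: "A x \<longleftrightarrow> A y" if "x \<^bold>\<in> cantor" "y \<^bold>\<in> cantor" "n \<^bold>\<in> omega"
    and diff: "\<And>j. j \<^bold>\<in> omega \<Longrightarrow> ap x j \<noteq> ap y j \<longleftrightarrow> j \<^bold>\<in> n" for x y n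
  proof -
    have "opair x y \<^bold>\<in> E0" by (rule E0_I[OF that])
    moreover have "opair (flipc x) (flipc y) \<^bold>\<in> E0"
    proof (rule E0_I[OF flipc(1) flipc(1) \<open>n \<^bold>\<in> omega\<close>])
      fix j assume j: "j \<^bold>\<in> omega"
      show "ap (flipc x) j \<noteq> ap (flipc y) j \<longleftrightarrow> j \<^bold>\<in> n"
        using diff[OF j] cantor_values[OF that(1) j] cantor_values[OF that(2) j]
        by (auto simp: flipc(2)[OF j])
    qed
    ultimately show ?thesis
      using E0 cls_eq_iff[OF eqv that(2), of x] cls_eq_iff[OF eqv flipc(1)[of y], of "flipc x"]
      by (simp add: A_def subset_def)
  qed
  have "\<not> AD"
  proof (rule not_AD[of A])
    show "definable (\<lambda>\<rho>. A (\<rho> 0))" unfolding A_def by (intro def_intros)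
    fix y assume y: "y \<^bold>\<in> funs omega omega" "inc y"
    \<comment> \<open>Two-valued sequences that agree exactly below \<open>ap y zero\<close> become,
      after flipping one of them, sequences that differ exactly there.\<close>
    have "A (blocks y) \<longleftrightarrow> A (flipc (blocks (shift y)))"
    proof (rule A_inv[OF blocks(1) flipc(1) ap_type[OF y(1) zero_omega]])
      fix j assume j: "j \<^bold>\<in> omega"
      show "ap (blocks y) j \<noteq> ap (flipc (blocks (shift y))) j \<longleftrightarrow> j \<^bold>\<in> ap y zero"
        using blocks_shift[OF y j] cantor_values[OF blocks(1) j, of y]
          cantor_values[OF blocks(1) j, of "shift y"]
        by (auto simp: flipc(2)[OF j])
    qed
    then show "A (blocks y) \<longleftrightarrow> \<not> A (blocks (shift y))"
      using A_flipc[OF blocks(1)] by simp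
  qed
  with \<open>AD\<close> show False by contradiction
qed

end

theorem theoremA2:
  fixes mem :: "'v \<Rightarrow> 'v \<Rightarrow> bool" and E :: 'v
  assumes "ZF mem" and "universe.AD mem"
    and "universe.equivalence_on mem (universe.cantor mem) E"
    and "universe.subset mem (universe.E0 mem) E"
    and "\<not> (\<exists>s x. mem s (universe.finseqs mem (universe.two mem)) \<and>
            mem x (universe.cantor mem) \<and>
            mem (universe.opair mem (universe.concat mem s x)
                  (universe.concat mem s (universe.flip mem x))) E)"
  shows "\<not> (\<exists>L. universe.linear_order_on mem
            (universe.quotient mem (universe.cantor mem) E) L)"
proof -
  interpret zf_universe mem
    by (simp add: zf_universe_def assms(1))
  have "\<not> mem (opair x (flipc x)) E" if x: "mem x cantor" for x
  proof
    assume "mem (opair x (flipc x)) E"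
    \<comment> \<open>The hypothesis is applied with the empty sequence as \<open>s\<close>, where
      it says that no \<open>x\<close> is equivalent to its flip.\<close>
    then have "mem (opair (concat zero x) (concat zero (flip x))) E"
      by (simp add: flip_eq_flipc[OF x] concat_empty x flipc(1))
    moreover have "mem zero (finseqs two)"
      by (auto simp: mem_finseqs mem_funs subset_def intro!: exI[of _ zero])
    ultimately show False
      using assms(5) x by blast
  qed
  then show ?thesis
    using quotient_not_linear[OF assms(2,3,4)] by blast
qed

end
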